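(* Let $T'$ be a complete countable NIP theory in a language $\mathcal L'$ with monster model $\mathcal U$, let $F\subseteq\mathcal U$ be a small subset, and let $T=\mathrm{Th}(\mathcal U_F)$ in the language $\mathcal L=\mathcal L'(F)$. Work in $T$ (with monster model again denoted $\mathcal U$), and let $A,B\subseteq\mathcal U$ be small sets. If $B$ is compressibly constructible over $A$, then $B$ is compressible over $A$.
   Context: $\mathcal U$ is a large saturated model; small means of cardinality $<|\mathcal U|$; $\vdash$ is implication in $\mathcal U$. $\mathcal U_F$ is the expansion of $\mathcal U$ by constants for the elements of $F$. A theory is NIP if for every formula $\phi(x,y)$ the family $\{\phi(\mathcal U^x,b):b\in\mathcal U^y\}$ has finite VC-dimension. A type $p(x)\in S(A)$ (in a possibly infinite tuple of variables) is compressible if for every $\mathcal L$-formula $\phi(x,y)$ there is an $\mathcal L$-formula $\psi(x,z)$ such that for every finite $A_0\subseteq A$ there is $c\in A^z$ with $\psi(x,c)\in p$ and $\psi(x,c)\vdash\{\phi(x,a)\in p:a\in A_0^y\}\cup\{\neg\phi(x,a)\in p:a\in A_0^y\}$. $B$ is compressibly constructible over $A$ if $B$ can be enumerated as $B=(b_i)_{i<\alpha}$ for some ordinal $\alpha$ such that $\mathrm{tp}(b_i/A\cup\{b_j:j<i\})$ is compressible for all $i<\alpha$. $B$ is compressible over $A$ if $\mathrm{tp}(\bar b/A)$ is compressible for some (equivalently any) tuple $\bar b$ enumerating $B$; equivalently, $\mathrm{tp}(b/A)$ is compressible for every finite tuple $b$ from $B$. *)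

theory Defs
  imports Main "HOL-Library.Countable_Set"
begin

section \<open>One-sorted first-order logic\<close>

record ('f, 'r) fo_language =
  funs :: "'f set"
  rels :: "'r set"
  fun_arity :: "'f \<Rightarrow> nat"
  rel_arity :: "'r \<Rightarrow> nat"

text \<open>The universe of a structure is the whole type \<open>'a\<close>.\<close>

record ('f, 'r, 'a) fo_structure =
  fun_interp :: "'f \<Rightarrow> 'a list \<Rightarrow> 'a"
  rel_interp :: "'r \<Rightarrow> 'a list \<Rightarrow> bool"

text \<open>
  Free variables are named by an arbitrary type \<open>'v\<close>, so that formulas in infinite tuples of
  variables make sense. Bound variables are de Bruijn indices.
\<close>

datatype (dead 'f, tm_vars: 'v) tm =
  Free 'v | Bound nat | App 'f "('f, 'v) tm list"

datatype (dead 'f, dead 'r, fm_vars: 'v) fm =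
  Eq "('f, 'v) tm" "('f, 'v) tm"
| Rel 'r "('f, 'v) tm list"
| Neg "('f, 'r, 'v) fm"
| Conj "('f, 'r, 'v) fm" "('f, 'r, 'v) fm"
| Exists "('f, 'r, 'v) fm"

primrec wf_tm :: "('f, 'r) fo_language \<Rightarrow> nat \<Rightarrow> ('f, 'v) tm \<Rightarrow> bool" where
  "wf_tm L k (Free x) \<longleftrightarrow> True"
| "wf_tm L k (Bound n) \<longleftrightarrow> n < k"
| "wf_tm L k (App f ts) \<longleftrightarrow> f \<in> funs L \<and> length ts = fun_arity L f \<and> list_all (wf_tm L k) ts"

primrec wf_fm :: "('f, 'r) fo_language \<Rightarrow> nat \<Rightarrow> ('f, 'r, 'v) fm \<Rightarrow> bool" where
  "wf_fm L k (Eq s t) \<longleftrightarrow> wf_tm L k s \<and> wf_tm L k t"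
| "wf_fm L k (Rel R ts) \<longleftrightarrow> R \<in> rels L \<and> length ts = rel_arity L R \<and> list_all (wf_tm L k) ts"
| "wf_fm L k (Neg \<phi>) \<longleftrightarrow> wf_fm L k \<phi>"
| "wf_fm L k (Conj \<phi> \<psi>) \<longleftrightarrow> wf_fm L k \<phi> \<and> wf_fm L k \<psi>"
| "wf_fm L k (Exists \<phi>) \<longleftrightarrow> wf_fm L (Suc k) \<phi>"

definition formulas :: "('f, 'r) fo_language \<Rightarrow> 'v set \<Rightarrow> ('f, 'r, 'v) fm set" where
  "formulas L V = {\<phi>. wf_fm L 0 \<phi> \<and> fm_vars \<phi> \<subseteq> V}"

text \<open>
  Here \<open>v\<close> assigns values to the free variables and \<open>bs\<close> to the bound ones; an \<open>L\<close>-formula is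
  evaluated with \<open>bs = []\<close>.
\<close>

primrec tm_val :: "('f, 'r, 'a) fo_structure \<Rightarrow> ('v \<Rightarrow> 'a) \<Rightarrow> 'a list \<Rightarrow> ('f, 'v) tm \<Rightarrow> 'a" where
  "tm_val M v bs (Free x) = v x"
| "tm_val M v bs (Bound n) = bs ! n"
| "tm_val M v bs (App f ts) = fun_interp M f (map (tm_val M v bs) ts)"

primrec sat :: "('f, 'r, 'a) fo_structure \<Rightarrow> ('v \<Rightarrow> 'a) \<Rightarrow> 'a list \<Rightarrow> ('f, 'r, 'v) fm \<Rightarrow> bool" where
  "sat M v bs (Eq s t) \<longleftrightarrow> tm_val M v bs s = tm_val M v bs t"
| "sat M v bs (Rel R ts) \<longleftrightarrow> rel_interp M R (map (tm_val M v bs) ts)"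
| "sat M v bs (Neg \<phi>) \<longleftrightarrow> \<not> sat M v bs \<phi>"
| "sat M v bs (Conj \<phi> \<psi>) \<longleftrightarrow> sat M v bs \<phi> \<and> sat M v bs \<psi>"
| "sat M v bs (Exists \<phi>) \<longleftrightarrow> (\<exists>u. sat M v (u # bs) \<phi>)"

definition add_constants :: "('f, 'r) fo_language \<Rightarrow> 'a set \<Rightarrow> ('f + 'a, 'r) fo_language" where
  "add_constants L C =
    \<lparr>funs = Inl ` funs L \<union> Inr ` C, rels = rels L,
     fun_arity = case_sum (fun_arity L) (\<lambda>_. 0), rel_arity = rel_arity L\<rparr>"

text \<open>
  The interpretation covers constants for all elements; the language \<open>add_constants L C\<close>
  determines which of them may occur in formulas.
\<close>

definition name_elements :: "('f, 'r, 'a) fo_structure \<Rightarrow> ('f + 'a, 'r, 'a) fo_structure" where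
  "name_elements M =
    \<lparr>fun_interp = case_sum (fun_interp M) (\<lambda>a _. a), rel_interp = rel_interp M\<rparr>"

definition tuples :: "'a set \<Rightarrow> nat \<Rightarrow> 'a list set" where
  "tuples A n = {as. length as = n \<and> set as \<subseteq> A}"

text \<open>
  A formula \<open>\<phi>(x,y)\<close> with \<open>x = (x\<^sub>i)\<^bsub>i\<in>I\<^esub>\<close> and \<open>y = (y\<^sub>0,\<dots>,y\<^bsub>m-1\<^esub>)\<close> has free variables \<open>Inl i\<close>
  for \<open>x\<^sub>i\<close> and \<open>Inr n\<close> for \<open>y\<^sub>n\<close>.
\<close>

definition formulas2 ::
    "('f, 'r) fo_language \<Rightarrow> 'i set \<Rightarrow> nat \<Rightarrow> ('f, 'r, 'i + nat) fm set" where
  "formulas2 L I m = formulas L (Inl ` I \<union> Inr ` {..<m})"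

text \<open>\<open>inst_fm a \<phi>\<close> is the formula \<open>\<phi>(x,a)\<close> in the language with constants.\<close>

fun inst_tm :: "'a list \<Rightarrow> ('f, 'i + nat) tm \<Rightarrow> ('f + 'a, 'i) tm" where
  "inst_tm a (Free (Inl i)) = Free i"
| "inst_tm a (Free (Inr n)) = App (Inr (a ! n)) []"
| "inst_tm a (Bound n) = Bound n"
| "inst_tm a (App f ts) = App (Inl f) (map (inst_tm a) ts)"

primrec inst_fm :: "'a list \<Rightarrow> ('f, 'r, 'i + nat) fm \<Rightarrow> ('f + 'a, 'r, 'i) fm" where
  "inst_fm a (Eq s t) = Eq (inst_tm a s) (inst_tm a t)"
| "inst_fm a (Rel R ts) = Rel R (map (inst_tm a) ts)"
| "inst_fm a (Neg \<phi>) = Neg (inst_fm a \<phi>)"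
| "inst_fm a (Conj \<phi> \<psi>) = Conj (inst_fm a \<phi>) (inst_fm a \<psi>)"
| "inst_fm a (Exists \<phi>) = Exists (inst_fm a \<phi>)"


section \<open>Types, saturation and monster models\<close>

definition complete_types ::
    "('f, 'r) fo_language \<Rightarrow> ('f, 'r, 'a) fo_structure \<Rightarrow> 'i set \<Rightarrow> 'a set \<Rightarrow>
      ('f + 'a, 'r, 'i) fm set set" where
  "complete_types L M I A =
    {p. p \<subseteq> formulas (add_constants L A) I \<and>
        (\<forall>q. finite q \<and> q \<subseteq> p \<longrightarrow> (\<exists>v. \<forall>\<phi>\<in>q. sat (name_elements M) v [] \<phi>)) \<and>
        (\<forall>\<phi>\<in>formulas (add_constants L A) I. \<phi> \<in> p \<or> Neg \<phi> \<in> p)}"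

definition tp ::
    "('f, 'r) fo_language \<Rightarrow> ('f, 'r, 'a) fo_structure \<Rightarrow> 'i set \<Rightarrow> ('i \<Rightarrow> 'a) \<Rightarrow> 'a set \<Rightarrow>
      ('f + 'a, 'r, 'i) fm set" where
  "tp L M I b A = {\<phi> \<in> formulas (add_constants L A) I. sat (name_elements M) b [] \<phi>}"

definition small :: "'a set \<Rightarrow> bool" where
  "small A \<longleftrightarrow> (card_of A, card_of (UNIV :: 'a set)) \<in> ordLess"

definition saturated :: "('f, 'r) fo_language \<Rightarrow> ('f, 'r, 'a) fo_structure \<Rightarrow> bool" where
  "saturated L M \<longleftrightarrow>
    (\<forall>A. small A \<longrightarrow>
      (\<forall>p\<in>complete_types L M (UNIV :: unit set) A.
        \<exists>u. \<forall>\<phi>\<in>p. sat (name_elements M) (\<lambda>_. u) [] \<phi>))"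

definition countable_language :: "('f, 'r) fo_language \<Rightarrow> bool" where
  "countable_language L \<longleftrightarrow> countable (funs L) \<and> countable (rels L)"

definition models :: "('f, 'r, 'a) fo_structure \<Rightarrow> ('f, 'r, 'v) fm set \<Rightarrow> bool" where
  "models M T \<longleftrightarrow> (\<forall>\<phi>\<in>T. \<forall>v. sat M v [] \<phi>)"

text \<open>
  Theories are taken to be deductively closed, so that \<open>T \<turnstile> \<phi>\<close> means \<open>\<phi> \<in> T\<close>. Consistency and
  deductive closure are not part of the definition below: they follow as soon as \<open>T\<close> has a
  model, and a monster model is always given. Then \<open>T\<close> is exactly the theory of that model.
\<close>

definition complete_theory :: "('f, 'r) fo_language \<Rightarrow> ('f, 'r, 'v) fm set \<Rightarrow> bool" where
  "complete_theory L T \<longleftrightarrow>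
    T \<subseteq> formulas L {} \<and> (\<forall>\<phi>\<in>formulas L {}. \<phi> \<in> T \<or> Neg \<phi> \<in> T)"

text \<open>For theories in a countable language, we read ``large'' as ``uncountable''.\<close>

definition monster_model ::
    "('f, 'r) fo_language \<Rightarrow> ('f, 'r, 'v) fm set \<Rightarrow> ('f, 'r, 'a) fo_structure \<Rightarrow> bool" where
  "monster_model L T M \<longleftrightarrow> models M T \<and> saturated L M \<and> uncountable (UNIV :: 'a set)"


section \<open>NIP\<close>

definition shatters :: "'a set set \<Rightarrow> 'a set \<Rightarrow> bool" where
  "shatters \<F> S \<longleftrightarrow> (\<forall>S'\<subseteq>S. \<exists>X\<in>\<F>. X \<inter> S = S')"

definition finite_VC_dim :: "'a set set \<Rightarrow> bool" where
  "finite_VC_dim \<F> \<longleftrightarrow> (\<exists>d. \<forall>S. finite S \<and> shatters \<F> S \<longrightarrow> card S \<le> d)"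

text \<open>\<open>NIP L M\<close> says that the theory of which \<open>M\<close> is the monster model is NIP.\<close>

definition NIP :: "('f, 'r) fo_language \<Rightarrow> ('f, 'r, 'a) fo_structure \<Rightarrow> bool" where
  "NIP L M \<longleftrightarrow>
    (\<forall>n m. \<forall>\<phi>\<in>formulas2 L {..<n} m.
      finite_VC_dim
        ((\<lambda>b. {a \<in> tuples UNIV n. sat M (case_sum (nth a) (nth b)) [] \<phi>}) ` tuples UNIV m))"


section \<open>Compressibility\<close>

definition implies :: "('f, 'r, 'a) fo_structure \<Rightarrow> ('f, 'r, 'v) fm \<Rightarrow> ('f, 'r, 'v) fm set \<Rightarrow> bool"
  where "implies M \<phi> \<Delta> \<longleftrightarrow> (\<forall>v. sat M v [] \<phi> \<longrightarrow> (\<forall>\<delta>\<in>\<Delta>. sat M v [] \<delta>))"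

definition compressible_type ::
    "('f, 'r) fo_language \<Rightarrow> ('f, 'r, 'a) fo_structure \<Rightarrow> 'i set \<Rightarrow> 'a set \<Rightarrow>
      ('f + 'a, 'r, 'i) fm set \<Rightarrow> bool" where
  "compressible_type L M I A p \<longleftrightarrow>
    p \<in> complete_types L M I A \<and>
    (\<forall>m. \<forall>\<phi>\<in>formulas2 L I m. \<exists>k. \<exists>\<psi>\<in>formulas2 L I k.
      \<forall>A\<^sub>0. finite A\<^sub>0 \<and> A\<^sub>0 \<subseteq> A \<longrightarrow>
        (\<exists>c\<in>tuples A k. inst_fm c \<psi> \<in> p \<and>
          implies (name_elements M) (inst_fm c \<psi>)
            ({inst_fm a \<phi> | a. a \<in> tuples A\<^sub>0 m \<and> inst_fm a \<phi> \<in> p} \<union>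
             {Neg (inst_fm a \<phi>) | a. a \<in> tuples A\<^sub>0 m \<and> Neg (inst_fm a \<phi>) \<in> p})))"

text \<open>
  An enumeration of \<open>B\<close> by an ordinal is given by a well-order \<open>r\<close> and a map on its field;
  \<open>underS r i\<close> is the set of proper predecessors of \<open>i\<close>. The type \<open>'i\<close> from which the ordinal is
  taken cannot be quantified over inside the definition, hence is a parameter.
\<close>

definition compressibly_constructible ::
    "'i itself \<Rightarrow> ('f, 'r) fo_language \<Rightarrow> ('f, 'r, 'a) fo_structure \<Rightarrow> 'a set \<Rightarrow> 'a set \<Rightarrow> bool"
  where
  "compressibly_constructible TYPE('i) L M A B \<longleftrightarrow>
    (\<exists>(r :: 'i rel) b. Well_order r \<and> B = b ` Field r \<and>
      (\<forall>i\<in>Field r. compressible_type L M (UNIV :: unit set) (A \<union> b ` underS r i)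
        (tp L M UNIV (\<lambda>_. b i) (A \<union> b ` underS r i))))"

text \<open>Every \<open>B\<close> is enumerated by a tuple indexed by a subset of \<open>'a\<close>, for instance by \<open>B\<close> itself.\<close>

definition compressible_over ::
    "('f, 'r) fo_language \<Rightarrow> ('f, 'r, 'a) fo_structure \<Rightarrow> 'a set \<Rightarrow> 'a set \<Rightarrow> bool" where
  "compressible_over L M A B \<longleftrightarrow>
    (\<exists>(I :: 'a set) b. b ` I = B \<and> compressible_type L M I A (tp L M I b A))"

end

theory Submission
  imports Defs "HOL-Library.Ramsey"
begin

text \<open>
  By induction along the enumeration it suffices to show: if \<open>C\<close> is compressible over \<open>A\<close> and \<open>e\<close> is
  compressible over \<open>A \<union> C\<close>, then \<open>C \<union> {e}\<close> is compressible over \<open>A\<close>. Splitting a formula into its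
  positive and negative instances, one may compress only those instances \<open>\<phi>(e,d,a)\<close> that hold.

  Suppose this fails for \<open>\<phi>\<close>. Since \<open>C\<close> is compressible over \<open>A\<close>, no formula \<open>\<delta>(y,\<kappa>)\<close> true at \<open>e\<close>, with
  \<open>\<kappa>\<close> from \<open>A \<union> C\<close>, can then imply finitely many instances in a uniform way; on the other hand finitely many
  instances follow from some \<open>\<psi>(y,c)\<close> with \<open>c\<close> from \<open>A \<union> C\<close>. Choose alternately instances \<open>a\<^sub>j\<close> and
  \<open>c\<^sub>j\<close> such that \<open>\<psi>(y,c\<^sub>j)\<close> implies the instances \<open>a\<^sub>i\<close> for \<open>i \<le> j\<close>, while any true condition on \<open>e\<close>
  that does not involve \<open>a\<^sub>t\<close> and the \<open>c\<^sub>j\<close> with \<open>j \<ge> t\<close> is satisfied by some \<open>y\<close> violating the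
  instance \<open>a\<^sub>t\<close>. On a sequence made homogeneous by Ramsey's theorem, consider how many earlier
  instances a replacement of \<open>c\<^sub>m\<close> can be made to violate (consistently with \<open>\<psi>\<close>) without
  disturbing the rest. If arbitrarily many, any set of instances can be violated, which contradicts
  NIP for the relation between parameters of \<open>\<psi>\<close> and instances. Otherwise the first failure, copied
  along the sequence, can be repaired independently in each copy by also moving \<open>e\<close>, and this again
  contradicts NIP.
\<close>

section \<open>Definable predicates\<close>

lemma finite_tm_vars: "finite (tm_vars t)"
  by (induction t) auto

lemma finite_fm_vars: "finite (fm_vars \<phi>)"
  by (induction \<phi>) (auto simp: finite_tm_vars)

lemma tm_val_cong: "(\<And>x. x \<in> tm_vars t \<Longrightarrow> v x = v' x) \<Longrightarrow> tm_val M v bs t = tm_val M v' bs t"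
proof (induction t)
  case (App f ts)
  then have "map (tm_val M v bs) ts = map (tm_val M v' bs) ts" by (intro map_cong refl) auto
  then show ?case by (simp only: tm_val.simps)
qed auto

lemma map_tm_val_cong:
  "(\<And>x. x \<in> (\<Union>t\<in>set ts. tm_vars t) \<Longrightarrow> v x = v' x) \<Longrightarrow> map (tm_val M v bs) ts = map (tm_val M v' bs) ts"
  by (intro map_cong refl tm_val_cong) auto

lemma sat_cong: "(\<And>x. x \<in> fm_vars \<phi> \<Longrightarrow> v x = v' x) \<Longrightarrow> sat M v bs \<phi> = sat M v' bs \<phi>"
proof (induction \<phi> arbitrary: bs)
  case (Eq s t)
  then have "tm_val M v bs s = tm_val M v' bs s" "tm_val M v bs t = tm_val M v' bs t"
    by (auto intro!: tm_val_cong)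
  then show ?case by simp
next
  case (Rel R ts)
  then have "map (tm_val M v bs) ts = map (tm_val M v' bs) ts"
    by (intro map_tm_val_cong) auto
  then show ?case by (simp only: sat.simps)
qed auto

lemma tm_val_map_tm: "tm_val M v bs (map_tm f t) = tm_val M (v \<circ> f) bs t"
  by (induction t) (auto intro!: arg_cong[where f = "fun_interp M _"])

lemma sat_map_fm: "sat M v bs (map_fm f \<phi>) = sat M (v \<circ> f) bs \<phi>"
  by (induction \<phi> arbitrary: bs) (auto simp: tm_val_map_tm comp_def cong: map_cong)

lemma wf_map_tm: "wf_tm L k (map_tm f t) = wf_tm L k t"
  by (induction t) (auto simp: list_all_iff)

lemma wf_map_fm: "wf_fm L k (map_fm f \<phi>) = wf_fm L k \<phi>"
  by (induction \<phi> arbitrary: k) (auto simp: wf_map_tm list_all_iff)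

text \<open>\<open>bind_fm z k \<phi>\<close> turns the free variable \<open>z\<close> of \<open>\<phi>\<close> into the outermost bound variable.\<close>

primrec bind_tm :: "'v \<Rightarrow> nat \<Rightarrow> ('f, 'v) tm \<Rightarrow> ('f, 'v) tm" where
  "bind_tm z k (Free x) = (if x = z then Bound k else Free x)"
| "bind_tm z k (Bound n) = Bound n"
| "bind_tm z k (App f ts) = App f (map (bind_tm z k) ts)"

primrec bind_fm :: "'v \<Rightarrow> nat \<Rightarrow> ('f, 'r, 'v) fm \<Rightarrow> ('f, 'r, 'v) fm" where
  "bind_fm z k (Eq s t) = Eq (bind_tm z k s) (bind_tm z k t)"
| "bind_fm z k (Rel R ts) = Rel R (map (bind_tm z k) ts)"
| "bind_fm z k (Neg \<phi>) = Neg (bind_fm z k \<phi>)"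
| "bind_fm z k (Conj \<phi> \<psi>) = Conj (bind_fm z k \<phi>) (bind_fm z k \<psi>)"
| "bind_fm z k (Exists \<phi>) = Exists (bind_fm z (Suc k) \<phi>)"

lemma wf_bind_tm: "wf_tm L k t \<Longrightarrow> wf_tm L (Suc k) (bind_tm z k t)"
  by (induction t) (auto simp: list_all_iff)

lemma wf_bind_fm: "wf_fm L k \<phi> \<Longrightarrow> wf_fm L (Suc k) (bind_fm z k \<phi>)"
  by (induction \<phi> arbitrary: k) (auto simp: wf_bind_tm list_all_iff)

lemma tm_vars_bind_tm: "tm_vars (bind_tm z k t) = tm_vars t - {z}"
  by (induction t) auto

lemma fm_vars_bind_fm: "fm_vars (bind_fm z k \<phi>) = fm_vars \<phi> - {z}"
  by (induction \<phi> arbitrary: k) (auto simp: tm_vars_bind_tm)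

lemma tm_val_bind_tm:
  "wf_tm L (length bs) t \<Longrightarrow> tm_val M v (bs @ [u]) (bind_tm z (length bs) t) = tm_val M (v(z := u)) bs t"
  by (induction t) (auto simp: nth_append list_all_iff intro!: arg_cong[where f = "fun_interp M _"])

lemma sat_bind_fm:
  "wf_fm L (length bs) \<phi> \<Longrightarrow> sat M v (bs @ [u]) (bind_fm z (length bs) \<phi>) = sat M (v(z := u)) bs \<phi>"
proof (induction \<phi> arbitrary: bs)
  case (Rel R ts)
  then have "map (tm_val M v (bs @ [u])) (map (bind_tm z (length bs)) ts) = map (tm_val M (v(z := u)) bs) ts"
    by (auto simp: list_all_iff tm_val_bind_tm)
  then show ?case unfolding sat.simps bind_fm.simps by (rule arg_cong)
next
  case (Exists \<phi>)
  then show ?case using Exists.IH[of "_ # bs"] by simp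
qed (auto simp: tm_val_bind_tm)

text \<open>Predicates on assignments replace formulas, so that renaming variables and quantifying
  over whole tuples become semantic operations. Parameters outside the language enter as values of
  variables.\<close>

definition definable ::
    "('f, 'r) fo_language \<Rightarrow> ('f, 'r, 'a) fo_structure \<Rightarrow> 'v set \<Rightarrow> (('v \<Rightarrow> 'a) \<Rightarrow> bool) \<Rightarrow> bool" where
  "definable L M V P \<longleftrightarrow> (\<exists>\<phi>\<in>formulas L V. \<forall>v. sat M v [] \<phi> \<longleftrightarrow> P v)"

lemma definable_sat: "\<phi> \<in> formulas L V \<Longrightarrow> definable L M V (\<lambda>v. sat M v [] \<phi>)"
  unfolding definable_def by blast

lemma definable_mono: "definable L M V P \<Longrightarrow> V \<subseteq> V' \<Longrightarrow> definable L M V' P"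
  unfolding definable_def formulas_def by blast

lemma definable_depends: "definable L M V P \<Longrightarrow> (\<And>x. x \<in> V \<Longrightarrow> v x = v' x) \<Longrightarrow> P v = P v'"
  unfolding definable_def formulas_def by (metis (mono_tags, lifting) mem_Collect_eq sat_cong subset_iff)

lemma definable_finite_support:
  assumes "definable L M V P"
  obtains V' where "finite V'" "V' \<subseteq> V" "definable L M V' P"
  using assms unfolding definable_def formulas_def by (metis (mono_tags, lifting) finite_fm_vars mem_Collect_eq subset_refl)

lemma definable_not: "definable L M V P \<Longrightarrow> definable L M V (\<lambda>v. \<not> P v)"
proof -
  assume "definable L M V P"
  then obtain \<phi> where "\<phi> \<in> formulas L V" "\<forall>v. sat M v [] \<phi> \<longleftrightarrow> P v"
    unfolding definable_def by blast
  then show ?thesis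
    unfolding definable_def by (intro bexI[of _ "Neg \<phi>"]) (auto simp: formulas_def)
qed

lemma definable_conj:
  assumes "definable L M V P" "definable L M V Q"
  shows "definable L M V (\<lambda>v. P v \<and> Q v)"
proof -
  obtain \<phi> \<psi> where "\<phi> \<in> formulas L V" "\<psi> \<in> formulas L V"
    "\<forall>v. sat M v [] \<phi> \<longleftrightarrow> P v" "\<forall>v. sat M v [] \<psi> \<longleftrightarrow> Q v"
    using assms unfolding definable_def by blast
  then show ?thesis
    unfolding definable_def by (intro bexI[of _ "Conj \<phi> \<psi>"]) (auto simp: formulas_def)
qed

lemma definable_True: "definable L M V (\<lambda>v. True)"
  unfolding definable_def
  by (rule bexI[of _ "Exists (Eq (Bound 0) (Bound 0))"]) (auto simp: formulas_def)

lemma definable_reindex: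
  assumes "definable L M V P" "f ` V \<subseteq> V'"
  shows "definable L M V' (\<lambda>v. P (v \<circ> f))"
proof -
  obtain \<phi> where "\<phi> \<in> formulas L V" "\<forall>v. sat M v [] \<phi> \<longleftrightarrow> P v"
    using assms unfolding definable_def by blast
  then show ?thesis
    using assms(2) unfolding definable_def
    by (intro bexI[of _ "map_fm f \<phi>"]) (auto simp: formulas_def sat_map_fm wf_map_fm fm.set_map)
qed

lemma definable_ex1:
  assumes "definable L M V P"
  shows "definable L M (V - {z}) (\<lambda>v. \<exists>u. P (v(z := u)))"
proof -
  obtain \<phi> where \<phi>: "\<phi> \<in> formulas L V" "\<forall>v. sat M v [] \<phi> \<longleftrightarrow> P v"
    using assms unfolding definable_def by blast
  then have "sat M v [] (Exists (bind_fm z 0 \<phi>)) \<longleftrightarrow> (\<exists>u. P (v(z := u)))" for v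
    using sat_bind_fm[of L "[]" \<phi> M v _ z] by (auto simp: formulas_def)
  moreover have "Exists (bind_fm z 0 \<phi>) \<in> formulas L (V - {z})"
    using \<phi>(1) wf_bind_fm[of L 0 \<phi> z] by (auto simp: formulas_def fm_vars_bind_fm)
  ultimately show ?thesis unfolding definable_def by blast
qed

lemma definable_ex_finite:
  "finite W \<Longrightarrow> definable L M V P \<Longrightarrow>
    definable L M (V - W) (\<lambda>v. \<exists>v'. (\<forall>x. x \<notin> W \<longrightarrow> v' x = v x) \<and> P v')"
proof (induction W arbitrary: V P rule: finite_induct)
  case empty
  then show ?case by (simp flip: fun_eq_iff)
next
  case (insert z W)
  have eq: "(\<exists>u v'. (\<forall>x. x \<notin> W \<longrightarrow> v' x = (v(z := u)) x) \<and> P v') \<longleftrightarrow>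
      (\<exists>v'. (\<forall>x. x \<notin> insert z W \<longrightarrow> v' x = v x) \<and> P v')" for v
  proof
    assume "\<exists>u v'. (\<forall>x. x \<notin> W \<longrightarrow> v' x = (v(z := u)) x) \<and> P v'"
    then obtain u v' where "\<forall>x. x \<notin> W \<longrightarrow> v' x = (v(z := u)) x" "P v'" by blast
    then show "\<exists>v'. (\<forall>x. x \<notin> insert z W \<longrightarrow> v' x = v x) \<and> P v'"
      by (intro exI[of _ v']) auto
  next
    assume "\<exists>v'. (\<forall>x. x \<notin> insert z W \<longrightarrow> v' x = v x) \<and> P v'"
    then obtain v' where "\<forall>x. x \<notin> insert z W \<longrightarrow> v' x = v x" "P v'" by blast
    then show "\<exists>u v'. (\<forall>x. x \<notin> W \<longrightarrow> v' x = (v(z := u)) x) \<and> P v'"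
      by (intro exI[of _ "v' z"] exI[of _ v']) auto
  qed
  have "V - W - {z} = V - insert z W" by auto
  then show ?case
    using definable_ex1[OF insert.IH[OF insert.prems], of z] unfolding eq by simp
qed

text \<open>\<open>W\<close> may be infinite; only those of its variables that lie in a finite
  support of \<open>P\<close> have to be quantified.\<close>

lemma definable_ex:
  assumes "definable L M V P"
  shows "definable L M (V - W) (\<lambda>v. \<exists>v'. (\<forall>x. x \<notin> W \<longrightarrow> v' x = v x) \<and> P v')"
proof -
  obtain V' where V': "finite V'" "V' \<subseteq> V" "definable L M V' P"
    using assms by (rule definable_finite_support)
  have eq: "(\<exists>v'. (\<forall>x. x \<notin> W \<inter> V' \<longrightarrow> v' x = v x) \<and> P v') \<longleftrightarrow>
      (\<exists>v'. (\<forall>x. x \<notin> W \<longrightarrow> v' x = v x) \<and> P v')" for v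
  proof
    assume "\<exists>v'. (\<forall>x. x \<notin> W \<longrightarrow> v' x = v x) \<and> P v'"
    then obtain v' where v': "\<forall>x. x \<notin> W \<longrightarrow> v' x = v x" "P v'" by blast
    then have "P (\<lambda>x. if x \<in> W \<inter> V' then v' x else v x)"
      using definable_depends[OF V'(3), of v' "\<lambda>x. if x \<in> W \<inter> V' then v' x else v x"] by auto
    then show "\<exists>v'. (\<forall>x. x \<notin> W \<inter> V' \<longrightarrow> v' x = v x) \<and> P v'"
      by (intro exI[of _ "\<lambda>x. if x \<in> W \<inter> V' then v' x else v x"]) auto
  qed auto
  have "definable L M (V' - W \<inter> V') (\<lambda>v. \<exists>v'. (\<forall>x. x \<notin> W \<inter> V' \<longrightarrow> v' x = v x) \<and> P v')"
    using definable_ex_finite[OF _ V'(3), of "W \<inter> V'"] V'(1) by simp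
  then show ?thesis
    unfolding eq by (rule definable_mono) (use V'(2) in auto)
qed

section \<open>NIP with constants\<close>

text \<open>NIP is assumed for the language without constants, so a constant \<open>Inr a\<close>
  becomes a free variable named by its own value; assigning \<open>id\<close> to these variables
  restores the formula.\<close>

primrec unname_tm :: "('f + 'a, 'v) tm \<Rightarrow> ('f, 'v + 'a) tm" where
  "unname_tm (Free x) = Free (Inl x)"
| "unname_tm (Bound n) = Bound n"
| "unname_tm (App f ts) = (case f of Inl g \<Rightarrow> App g (map unname_tm ts) | Inr a \<Rightarrow> Free (Inr a))"

primrec unname_fm :: "('f + 'a, 'r, 'v) fm \<Rightarrow> ('f, 'r, 'v + 'a) fm" where
  "unname_fm (Eq s t) = Eq (unname_tm s) (unname_tm t)"
| "unname_fm (Rel R ts) = Rel R (map unname_tm ts)"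
| "unname_fm (Neg \<phi>) = Neg (unname_fm \<phi>)"
| "unname_fm (Conj \<phi> \<psi>) = Conj (unname_fm \<phi>) (unname_fm \<psi>)"
| "unname_fm (Exists \<phi>) = Exists (unname_fm \<phi>)"

lemma wf_unname_tm: "wf_tm (add_constants L F) k t \<Longrightarrow> wf_tm L k (unname_tm t)"
  by (induction t) (auto simp: add_constants_def list_all_iff)

lemma wf_unname_fm: "wf_fm (add_constants L F) k \<phi> \<Longrightarrow> wf_fm L k (unname_fm \<phi>)"
  by (induction \<phi> arbitrary: k) (auto simp: wf_unname_tm list_all_iff add_constants_def)

lemma rel_interp_name_elements: "rel_interp (name_elements M) = rel_interp M"
  by (simp add: name_elements_def)

lemma tm_val_unname_tm: "tm_val M (case_sum v id) bs (unname_tm t) = tm_val (name_elements M) v bs t"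
  by (induction t) (auto simp: name_elements_def split: sum.splits
      intro!: arg_cong[where f = "fun_interp M _"])

lemma sat_unname_fm: "sat M (case_sum v id) bs (unname_fm \<phi>) = sat (name_elements M) v bs \<phi>"
  by (induction \<phi> arbitrary: bs) (simp_all add: tm_val_unname_tm comp_def rel_interp_name_elements)

text \<open>Constants are absorbed into the shattering parameter, which is lengthened by their fixed
  values. A formula has finitely many variables, which cuts points and parameters down to finite
  tuples.\<close>

lemma NIP_definable:
  fixes P :: "('w + 'e \<Rightarrow> 'a) \<Rightarrow> bool"
  assumes "NIP L U" and "definable (add_constants L F) (name_elements U) V P"
  shows "\<exists>d. \<forall>(n::nat) e. (\<forall>I\<subseteq>{..<n}. \<exists>w. \<forall>i<n. P (case_sum w (e i)) \<longleftrightarrow> i \<in> I) \<longrightarrow> n \<le> d"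
proof -
  obtain \<phi> where \<phi>: "\<phi> \<in> formulas (add_constants L F) V" "\<And>v. sat (name_elements U) v [] \<phi> \<longleftrightarrow> P v"
    using assms(2) unfolding definable_def by blast
  define \<psi> where "\<psi> = unname_fm \<phi>"
  define E where "E = {e. Inl (Inr e) \<in> fm_vars \<psi>}"
  define W where "W = fm_vars \<psi> - Inl ` Inr ` E"
  have "finite ((Inl \<circ> Inr) ` E :: (('w + 'e) + 'a) set)"
    by (rule finite_subset[OF _ finite_fm_vars[of \<psi>]]) (auto simp: E_def)
  then have finE: "finite E" by (rule finite_imageD) (auto simp: inj_on_def)
  have finW: "finite W" by (simp add: W_def finite_fm_vars)
  \<comment> \<open>Coordinates of the points go to the left; the coordinates of \<open>w\<close>,
    together with the constants, go to the right, which is the parameter side.\<close>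
  define f :: "('w + 'e) + 'a \<Rightarrow> nat + nat" where
    "f x = (case x of Inl (Inr e) \<Rightarrow> Inl (to_nat_on E e) | _ \<Rightarrow> Inr (to_nat_on W x))" for x
  define \<theta> where "\<theta> = map_fm f \<psi>"
  have less: "e \<in> E \<Longrightarrow> to_nat_on E e < card E" "x \<in> W \<Longrightarrow> to_nat_on W x < card W" for e x
    using to_nat_on_finite[OF finE] to_nat_on_finite[OF finW] by (auto dest: bij_betwE)
  have "f x \<in> Inl ` {..<card E} \<union> Inr ` {..<card W}" if "x \<in> fm_vars \<psi>" for x
    using that less by (auto simp: f_def E_def W_def split: sum.splits)
  then have "\<theta> \<in> formulas2 L {..<card E} (card W)"
    using \<phi>(1) wf_unname_fm by (auto simp: \<theta>_def \<psi>_def formulas2_def formulas_def wf_map_fm fm.set_map)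
  then have "finite_VC_dim ((\<lambda>b. {a \<in> tuples UNIV (card E). sat U (case_sum (nth a) (nth b)) [] \<theta>}) ` tuples UNIV (card W))"
    using assms(1) unfolding NIP_def by blast
  then obtain d where d: "\<And>S. finite S \<Longrightarrow> shatters ((\<lambda>b. {a \<in> tuples UNIV (card E). sat U (case_sum (nth a) (nth b)) [] \<theta>}) ` tuples UNIV (card W)) S \<Longrightarrow> card S \<le> d"
    unfolding finite_VC_dim_def by blast
  have "n \<le> d" if shat: "\<And>I. I \<subseteq> {..<n} \<Longrightarrow> \<exists>w. \<forall>i<n. P (case_sum w (e i)) \<longleftrightarrow> i \<in> I" for n :: nat and e
  proof -
    define t where "t i = map (\<lambda>k. e i (from_nat_into E k)) [0..<card E]" for i
    define b where "b w = map (\<lambda>k. case_sum (case_sum w undefined) id (from_nat_into W k)) [0..<card W]" for w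
    have sat_eq: "sat U (case_sum (nth (t i)) (nth (b w))) [] \<theta> \<longleftrightarrow> P (case_sum w (e i))" for i w
    proof -
      have "sat U (case_sum (nth (t i)) (nth (b w))) [] \<theta> =
          sat U (case_sum (case_sum w (e i)) id) [] \<psi>"
        unfolding \<theta>_def sat_map_fm
      proof (rule sat_cong)
        fix x assume x: "x \<in> fm_vars \<psi>"
        show "(case_sum (nth (t i)) (nth (b w)) \<circ> f) x = case_sum (case_sum w (e i)) id x"
        proof (cases "\<exists>e. x = Inl (Inr e)")
          case True
          then obtain e' where e': "x = Inl (Inr e')" by blast
          then have "e' \<in> E" using x by (simp add: E_def)
          then show ?thesis using e' less(1)[of e'] finE
            by (simp add: f_def t_def countable_finite)
        next
          case False
          then have W: "x \<in> W" using x by (auto simp: W_def)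
          have "f x = Inr (to_nat_on W x)" using False by (auto simp: f_def split: sum.splits)
          moreover have "case_sum (case_sum w undefined) id x = case_sum (case_sum w (e i)) id x"
            using False by (auto split: sum.splits)
          ultimately show ?thesis using W less(2)[OF W] finW
            by (simp add: b_def countable_finite)
        qed
      qed
      then show ?thesis by (simp add: \<psi>_def sat_unname_fm \<phi>(2))
    qed
    \<comment> \<open>The singletons \<open>I\<close> already separate the points, so a shattered
      indexed family has no repetitions.\<close>
    have inj: "inj_on t {..<n}"
    proof (rule inj_onI)
      fix i j assume ij: "i \<in> {..<n}" "j \<in> {..<n}" "t i = t j"
      then have "{i} \<subseteq> {..<n}" by simp
      from shat[OF this] obtain w where w: "\<forall>l<n. P (case_sum w (e l)) \<longleftrightarrow> l \<in> {i}" by blast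
      then have "P (case_sum w (e i))" using ij by blast
      then have "P (case_sum w (e j))" using sat_eq[of i w] sat_eq[of j w] ij(3) by simp
      then show "i = j" using w ij by blast
    qed
    have "shatters ((\<lambda>b. {a \<in> tuples UNIV (card E). sat U (case_sum (nth a) (nth b)) [] \<theta>}) ` tuples UNIV (card W)) (t ` {..<n})"
      unfolding shatters_def
    proof (intro allI impI)
      fix S' assume S': "S' \<subseteq> t ` {..<n}"
      obtain w where w: "\<And>i. i < n \<Longrightarrow> P (case_sum w (e i)) \<longleftrightarrow> t i \<in> S'"
      proof -
        have "{i\<in>{..<n}. t i \<in> S'} \<subseteq> {..<n}" by blast
        from shat[OF this] show ?thesis using that by blast
      qed
      have "{a \<in> tuples UNIV (card E). sat U (case_sum (nth a) (nth (b w))) [] \<theta>} \<inter> t ` {..<n} = S'"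
      proof -
        have "t i \<in> tuples UNIV (card E)" for i by (simp add: t_def tuples_def)
        then show ?thesis using S' w sat_eq by auto
      qed
      moreover have "b w \<in> tuples UNIV (card W)" by (simp add: b_def tuples_def)
      ultimately show "\<exists>X\<in>(\<lambda>b. {a \<in> tuples UNIV (card E). sat U (case_sum (nth a) (nth b)) [] \<theta>}) ` tuples UNIV (card W). X \<inter> t ` {..<n} = S'"
        by blast
    qed
    then have "card (t ` {..<n}) \<le> d" by (intro d) auto
    then show ?thesis by (simp add: card_image inj)
  qed
  then show ?thesis by blast
qed

section \<open>Compressibility, semantically\<close>

text \<open>
  For nonempty \<open>A\<close> this is compressibility of \<open>tp(b/A)\<close>; for \<open>A = {}\<close> there is no \<open>c\<close>, since
  parameter tuples have infinite length here.
\<close>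

definition compressible ::
    "('f, 'r) fo_language \<Rightarrow> ('f, 'r, 'a) fo_structure \<Rightarrow> 'i set \<Rightarrow> 'a set \<Rightarrow> ('i \<Rightarrow> 'a) \<Rightarrow> bool" where
  "compressible L M S A b \<longleftrightarrow>
    (\<forall>P. definable L M (Inl ` S \<union> range Inr) P \<longrightarrow>
      (\<exists>Q. definable L M (Inl ` S \<union> range (Inr :: nat \<Rightarrow> _)) Q \<and>
        (\<forall>G. finite G \<longrightarrow> (\<forall>a\<in>G. range a \<subseteq> A) \<longrightarrow>
          (\<exists>c. range c \<subseteq> A \<and> Q (case_sum b c) \<and>
            (\<forall>v. Q (case_sum v c) \<longrightarrow> (\<forall>a\<in>G. P (case_sum v (a :: nat \<Rightarrow> _)) \<longleftrightarrow> P (case_sum b a)))))))"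

text \<open>A formula mentions finitely many parameters, so any index type can be traded for
  \<open>nat\<close>; \<open>g\<close> pulls the parameter tuples back.\<close>

lemma definable_renumber:
  fixes P :: "('i + 'k \<Rightarrow> 'a) \<Rightarrow> bool"
  assumes "definable L M (Inl ` S \<union> range Inr) P"
  shows "\<exists>P' (g :: nat \<Rightarrow> 'k). definable L M (Inl ` S \<union> range Inr) P' \<and>
    (\<forall>v c. P' (case_sum v (c \<circ> g)) \<longleftrightarrow> P (case_sum v c))"
proof -
  obtain V where V: "finite V" "V \<subseteq> Inl ` S \<union> range Inr" "definable L M V P"
    using assms by (rule definable_finite_support)
  define K where "K = insert undefined {k. Inr k \<in> V}"
  have "finite (Inr ` {k. Inr k \<in> V} :: ('i + 'k) set)" by (rule finite_subset[OF _ V(1)]) auto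
  then have "finite {k. Inr k \<in> V}" by (rule finite_imageD) auto
  then have K: "countable K" by (simp add: K_def countable_finite)
  show ?thesis
  proof (intro exI conjI allI)
    show "definable L M (Inl ` S \<union> range Inr) (\<lambda>v. P (v \<circ> map_sum id (to_nat_on K)))"
      by (rule definable_reindex[OF V(3)]) (use V(2) in auto)
    show "P (case_sum v (c \<circ> from_nat_into K) \<circ> map_sum id (to_nat_on K)) \<longleftrightarrow> P (case_sum v c)" for v c
    proof (rule definable_depends[OF V(3)])
      fix x assume "x \<in> V"
      then show "(case_sum v (c \<circ> from_nat_into K) \<circ> map_sum id (to_nat_on K)) x = case_sum v c x"
        using K by (cases x) (auto simp: K_def)
    qed
  qed
qed

lemma compressibleD:
  fixes P :: "('i + 'k \<Rightarrow> 'a) \<Rightarrow> bool"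
  assumes "compressible L M S A b" and P: "definable L M (Inl ` S \<union> range Inr) P"
  shows "\<exists>Q. definable L M (Inl ` S \<union> range (Inr :: nat \<Rightarrow> _)) Q \<and>
    (\<forall>G. finite G \<longrightarrow> (\<forall>a\<in>G. range a \<subseteq> A) \<longrightarrow>
      (\<exists>c. range c \<subseteq> A \<and> Q (case_sum b c) \<and>
        (\<forall>v. Q (case_sum v c) \<longrightarrow> (\<forall>a\<in>G. P (case_sum v a) \<longleftrightarrow> P (case_sum b a)))))"
proof -
  obtain P' and g :: "nat \<Rightarrow> 'k" where P': "definable L M (Inl ` S \<union> range Inr) P'"
    "\<And>v c. P' (case_sum v (c \<circ> g)) \<longleftrightarrow> P (case_sum v c)"
    using definable_renumber[OF P] by blast
  from assms(1)[unfolded compressible_def, THEN spec, THEN mp, OF P'(1)]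
  obtain Q where Q: "definable L M (Inl ` S \<union> range (Inr :: nat \<Rightarrow> _)) Q"
    and c: "\<forall>G. finite G \<longrightarrow> (\<forall>a\<in>G. range a \<subseteq> A) \<longrightarrow>
          (\<exists>c. range c \<subseteq> A \<and> Q (case_sum b c) \<and>
            (\<forall>v. Q (case_sum v c) \<longrightarrow> (\<forall>a\<in>G. P' (case_sum v a) \<longleftrightarrow> P' (case_sum b a))))"
    by (elim exE conjE)
  have "\<exists>c. range c \<subseteq> A \<and> Q (case_sum b c) \<and>
      (\<forall>v. Q (case_sum v c) \<longrightarrow> (\<forall>a\<in>G. P (case_sum v a) \<longleftrightarrow> P (case_sum b a)))"
    if "finite G" "\<forall>a\<in>G. range a \<subseteq> A" for G :: "('k \<Rightarrow> 'a) set"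
  proof -
    have "finite ((\<lambda>a. a \<circ> g) ` G)" "\<forall>a\<in>(\<lambda>a. a \<circ> g) ` G. range a \<subseteq> A"
      using that by auto
    from c[THEN spec, THEN mp, THEN mp, OF this] show ?thesis by (simp add: P'(2))
  qed
  with Q show ?thesis by blast
qed

lemma compressible_empty:
  fixes b :: "'i \<Rightarrow> 'a"
  assumes "A \<noteq> {}"
  shows "compressible L M {} A b"
  unfolding compressible_def
proof (intro allI impI)
  fix P :: "('i + nat \<Rightarrow> 'a) \<Rightarrow> bool"
  assume P: "definable L M (Inl ` {} \<union> range Inr) P"
  obtain a0 where "a0 \<in> A" using assms by blast
  moreover have "P (case_sum v a) = P (case_sum b a)" for v a
    by (rule definable_depends[OF P]) auto
  ultimately show "\<exists>Q. definable L M (Inl ` {} \<union> range (Inr :: nat \<Rightarrow> _)) Q \<and>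
        (\<forall>G. finite G \<longrightarrow> (\<forall>a\<in>G. range a \<subseteq> A) \<longrightarrow>
          (\<exists>c. range c \<subseteq> A \<and> Q (case_sum b c) \<and>
            (\<forall>v. Q (case_sum v c) \<longrightarrow> (\<forall>a\<in>G. P (case_sum v (a :: nat \<Rightarrow> _)) \<longleftrightarrow> P (case_sum b a)))))"
    by (intro exI[of _ "\<lambda>_. True"] conjI definable_True allI impI exI[of _ "\<lambda>_. a0"]) auto
qed

text \<open>A formula mentions finitely many coordinates of the tuple, and some member of the chain
  contains them all.\<close>

lemma compressible_Union_chain:
  fixes b :: "'i \<Rightarrow> 'a"
  assumes chain: "subset.chain UNIV \<S>" "\<S> \<noteq> {}" and comp: "\<And>S. S \<in> \<S> \<Longrightarrow> compressible L M S A b"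
  shows "compressible L M (\<Union>\<S>) A b"
  unfolding compressible_def
proof (intro allI impI)
  fix P :: "('i + nat \<Rightarrow> 'a) \<Rightarrow> bool"
  assume "definable L M (Inl ` \<Union>\<S> \<union> range Inr) P"
  then obtain V where V: "finite V" "V \<subseteq> Inl ` \<Union>\<S> \<union> range Inr" "definable L M V P"
    by (rule definable_finite_support)
  define S0 where "S0 = {x. Inl x \<in> V}"
  have "finite (Inl ` S0 :: ('i + nat) set)" by (rule finite_subset[OF _ V(1)]) (auto simp: S0_def)
  then have "finite S0" by (rule finite_imageD) auto
  moreover have "S0 \<subseteq> \<Union>\<S>" using V(2) by (auto simp: S0_def)
  ultimately obtain S where S: "S \<in> \<S>" "S0 \<subseteq> S"
    using finite_subset_Union_chain[OF _ _ chain(2,1)] by metis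
  have "V \<subseteq> Inl ` S \<union> range Inr"
  proof
    fix x assume "x \<in> V"
    then show "x \<in> Inl ` S \<union> range Inr" using S(2) by (cases x) (auto simp: S0_def)
  qed
  then have "definable L M (Inl ` S \<union> range Inr) P" using V(3) definable_mono by blast
  from comp[OF S(1), unfolded compressible_def, THEN spec, THEN mp, OF this]
  obtain Q where Q: "definable L M (Inl ` S \<union> range (Inr :: nat \<Rightarrow> _)) Q"
    "\<forall>G. finite G \<longrightarrow> (\<forall>a\<in>G. range a \<subseteq> A) \<longrightarrow>
          (\<exists>c. range c \<subseteq> A \<and> Q (case_sum b c) \<and>
            (\<forall>v. Q (case_sum v c) \<longrightarrow> (\<forall>a\<in>G. P (case_sum v (a :: nat \<Rightarrow> _)) \<longleftrightarrow> P (case_sum b a))))"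
    by (elim exE conjE)
  have "definable L M (Inl ` \<Union>\<S> \<union> range (Inr :: nat \<Rightarrow> _)) Q"
    by (rule definable_mono[OF Q(1)]) (use S(1) in auto)
  then show "\<exists>Q. definable L M (Inl ` \<Union>\<S> \<union> range (Inr :: nat \<Rightarrow> _)) Q \<and>
        (\<forall>G. finite G \<longrightarrow> (\<forall>a\<in>G. range a \<subseteq> A) \<longrightarrow>
          (\<exists>c. range c \<subseteq> A \<and> Q (case_sum b c) \<and>
            (\<forall>v. Q (case_sum v c) \<longrightarrow> (\<forall>a\<in>G. P (case_sum v (a :: nat \<Rightarrow> _)) \<longleftrightarrow> P (case_sum b a)))))"
    using Q(2) by blast
qed

section \<open>Compressible types in terms of definable predicates\<close>

lemma wf_inst_tm:
  "wf_tm L k t \<Longrightarrow> tm_vars t \<subseteq> Inl ` S \<union> Inr ` {..<length a} \<Longrightarrow> set a \<subseteq> A \<Longrightarrow>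
    wf_tm (add_constants L A) k (inst_tm a t) \<and> tm_vars (inst_tm a t) \<subseteq> S"
proof (induction a t rule: inst_tm.induct)
  case (4 a f ts)
  then have "wf_tm (add_constants L A) k (inst_tm a t) \<and> tm_vars (inst_tm a t) \<subseteq> S" if "t \<in> set ts" for t
    using that by (intro 4) (auto simp: list_all_iff)
  then show ?case using 4 by (force simp: list_all_iff add_constants_def)
next
  case (2 a n)
  then have "a ! n \<in> A" by (auto dest: nth_mem)
  then show ?case by (simp add: add_constants_def)
qed (auto simp: add_constants_def)

lemma wf_inst_fm:
  "wf_fm L k \<phi> \<Longrightarrow> fm_vars \<phi> \<subseteq> Inl ` S \<union> Inr ` {..<length a} \<Longrightarrow> set a \<subseteq> A \<Longrightarrow>
    wf_fm (add_constants L A) k (inst_fm a \<phi>) \<and> fm_vars (inst_fm a \<phi>) \<subseteq> S"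
proof (induction \<phi> arbitrary: k)
  case (Eq s t)
  then show ?case using wf_inst_tm[of L k s S a A] wf_inst_tm[of L k t S a A] by auto
next
  case (Rel R ts)
  then have "wf_tm (add_constants L A) k (inst_tm a t) \<and> tm_vars (inst_tm a t) \<subseteq> S" if "t \<in> set ts" for t
    using wf_inst_tm[of L k t S a A] that by (force simp: list_all_iff)
  then show ?case using Rel by (force simp: list_all_iff add_constants_def)
qed auto

lemma inst_fm_in_formulas:
  "\<phi> \<in> formulas2 L S m \<Longrightarrow> a \<in> tuples A m \<Longrightarrow> inst_fm a \<phi> \<in> formulas (add_constants L A) S"
  using wf_inst_fm[of L 0 \<phi> S a A] by (auto simp: formulas2_def formulas_def tuples_def)

lemma tm_val_inst_tm: "tm_val (name_elements M) v bs (inst_tm a t) = tm_val M (case_sum v (nth a)) bs t"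
  by (induction a t rule: inst_tm.induct) (auto simp: name_elements_def
      intro!: arg_cong[where f = "fun_interp M _"])

lemma sat_inst_fm: "sat (name_elements M) v bs (inst_fm a \<phi>) = sat M (case_sum v (nth a)) bs \<phi>"
  by (induction \<phi> arbitrary: bs) (simp_all add: tm_val_inst_tm comp_def rel_interp_name_elements)

lemma sat_formulas2_cong:
  assumes "\<phi> \<in> formulas2 L S m" "\<And>i. i \<in> S \<Longrightarrow> v i = v' i" "\<And>n. n < m \<Longrightarrow> a n = a' n"
  shows "sat M (case_sum v a) bs \<phi> = sat M (case_sum v' a') bs \<phi>"
  by (rule sat_cong) (use assms in \<open>auto simp: formulas2_def formulas_def\<close>)

lemma formulas_eq_formulas2:
  fixes \<phi> :: "('f, 'r, 'i + nat) fm"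
  assumes "\<phi> \<in> formulas L (Inl ` S \<union> range Inr)"
  obtains m where "\<phi> \<in> formulas2 L S m"
proof -
  have "finite (Inr ` {n. Inr n \<in> fm_vars \<phi>} :: ('i + nat) set)"
    by (rule finite_subset[OF _ finite_fm_vars[of \<phi>]]) auto
  then have "finite {n. Inr n \<in> fm_vars \<phi>}" by (rule finite_imageD) auto
  then obtain m where "{n. Inr n \<in> fm_vars \<phi>} \<subseteq> {..<m}"
    using finite_nat_bounded by blast
  moreover have "x \<in> Inl ` S \<union> Inr ` {..<m}" if "x \<in> fm_vars \<phi>" for x
  proof (cases x)
    case (Inl i)
    then show ?thesis using that assms by (auto simp: formulas_def)
  next
    case (Inr n)
    then show ?thesis using that calculation by auto
  qed
  ultimately have "\<phi> \<in> formulas2 L S m"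
    using assms by (auto simp: formulas2_def formulas_def)
  then show thesis by (rule that)
qed

lemma formulas2_subset: "formulas2 L S m \<subseteq> formulas L (Inl ` S \<union> range Inr)"
  by (auto simp: formulas2_def formulas_def)

lemma tp_complete: "tp L M I b A \<in> complete_types L M I A"
  unfolding complete_types_def tp_def formulas_def by auto

lemma compressible_type_imp_compressible:
  fixes b :: "'i \<Rightarrow> 'a"
  assumes "compressible_type L M S A (tp L M S b A)" "A \<noteq> {}"
  shows "compressible L M S A b"
  unfolding compressible_def
proof (intro allI impI)
  fix P :: "('i + nat \<Rightarrow> 'a) \<Rightarrow> bool"
  assume "definable L M (Inl ` S \<union> range Inr) P"
  then obtain \<phi> where \<phi>: "\<phi> \<in> formulas L (Inl ` S \<union> range Inr)" "\<And>v. sat M v [] \<phi> \<longleftrightarrow> P v"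
    unfolding definable_def by blast
  obtain a0 where a0: "a0 \<in> A" using assms(2) by blast
  obtain m where m: "\<phi> \<in> formulas2 L S m" using \<phi>(1) by (rule formulas_eq_formulas2)
  let ?p = "tp L M S b A"
  obtain k \<psi> where \<psi>: "\<psi> \<in> formulas2 L S k" and comp: "\<forall>A\<^sub>0. finite A\<^sub>0 \<and> A\<^sub>0 \<subseteq> A \<longrightarrow>
        (\<exists>c\<in>tuples A k. inst_fm c \<psi> \<in> ?p \<and>
          implies (name_elements M) (inst_fm c \<psi>)
            ({inst_fm a \<phi> | a. a \<in> tuples A\<^sub>0 m \<and> inst_fm a \<phi> \<in> ?p} \<union>
             {Neg (inst_fm a \<phi>) | a. a \<in> tuples A\<^sub>0 m \<and> Neg (inst_fm a \<phi>) \<in> ?p}))"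
    using assms(1)[unfolded compressible_type_def, THEN conjunct2, rule_format, OF m]
    by (elim exE bexE)
  define Q where "Q v = sat M v [] \<psi>" for v
  have "\<exists>c. range c \<subseteq> A \<and> Q (case_sum b c) \<and>
      (\<forall>v. Q (case_sum v c) \<longrightarrow> (\<forall>a\<in>G. P (case_sum v a) \<longleftrightarrow> P (case_sum b a)))"
    if G: "finite G" "\<forall>a\<in>G. range a \<subseteq> A" for G
  proof -
    define A\<^sub>0 where "A\<^sub>0 = (\<Union>a\<in>G. a ` {..<m})"
    have "finite A\<^sub>0" "A\<^sub>0 \<subseteq> A" using G by (auto simp: A\<^sub>0_def)
    with comp obtain c where c: "c \<in> tuples A k" "inst_fm c \<psi> \<in> ?p"
      and imp: "implies (name_elements M) (inst_fm c \<psi>)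
            ({inst_fm a \<phi> | a. a \<in> tuples A\<^sub>0 m \<and> inst_fm a \<phi> \<in> ?p} \<union>
             {Neg (inst_fm a \<phi>) | a. a \<in> tuples A\<^sub>0 m \<and> Neg (inst_fm a \<phi>) \<in> ?p})"
      by blast
    \<comment> \<open>Parameter tuples are infinite on the semantic side; \<open>a0\<close> fills
      the positions that \<open>\<psi>\<close> does not mention.\<close>
    define c' where "c' n = (if n < k then c ! n else a0)" for n
    have Q: "Q (case_sum v c') \<longleftrightarrow> sat (name_elements M) v [] (inst_fm c \<psi>)" for v
      unfolding Q_def sat_inst_fm by (rule sat_formulas2_cong[OF \<psi>]) (auto simp: c'_def)
    have "P (case_sum v a) \<longleftrightarrow> P (case_sum b a)" if v: "Q (case_sum v c')" and a: "a \<in> G" for v a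
    proof -
      define l where "l = map a [0..<m]"
      have l: "l \<in> tuples A\<^sub>0 m" using a by (auto simp: l_def tuples_def A\<^sub>0_def)
      have eq: "P (case_sum v a) \<longleftrightarrow> sat (name_elements M) v [] (inst_fm l \<phi>)" for v
        unfolding \<phi>(2)[symmetric] sat_inst_fm by (rule sat_formulas2_cong[OF m]) (auto simp: l_def)
      have fm: "inst_fm l \<phi> \<in> formulas (add_constants L A) S"
        by (rule inst_fm_in_formulas[OF m]) (use l \<open>A\<^sub>0 \<subseteq> A\<close> in \<open>auto simp: tuples_def\<close>)
      have "sat (name_elements M) v [] \<delta>" if "\<delta> \<in> {inst_fm a \<phi> | a. a \<in> tuples A\<^sub>0 m \<and> inst_fm a \<phi> \<in> ?p} \<union>
             {Neg (inst_fm a \<phi>) | a. a \<in> tuples A\<^sub>0 m \<and> Neg (inst_fm a \<phi>) \<in> ?p}" for \<delta>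
        using imp v that unfolding implies_def Q by blast
      \<comment> \<open>The type contains the instance or its negation, so implying its members
        yields an equivalence.\<close>
      from this[of "inst_fm l \<phi>"] this[of "Neg (inst_fm l \<phi>)"]
      show ?thesis using l fm unfolding eq tp_def formulas_def by auto
    qed
    moreover have "range c' \<subseteq> A" using c(1) a0 by (auto simp: c'_def tuples_def)
    moreover have "Q (case_sum b c')" using c(2) by (simp add: Q tp_def)
    ultimately show ?thesis by blast
  qed
  moreover have "definable L M (Inl ` S \<union> range Inr) Q"
    unfolding Q_def using \<psi> formulas2_subset by (intro definable_sat) blast
  ultimately show "\<exists>Q. definable L M (Inl ` S \<union> range (Inr :: nat \<Rightarrow> _)) Q \<and>
        (\<forall>G. finite G \<longrightarrow> (\<forall>a\<in>G. range a \<subseteq> A) \<longrightarrow>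
          (\<exists>c. range c \<subseteq> A \<and> Q (case_sum b c) \<and>
            (\<forall>v. Q (case_sum v c) \<longrightarrow> (\<forall>a\<in>G. P (case_sum v (a :: nat \<Rightarrow> _)) \<longleftrightarrow> P (case_sum b a)))))"
    by blast
qed

lemma compressible_imp_compressible_type:
  assumes "compressible L M S A b" "A \<noteq> {}"
  shows "compressible_type L M S A (tp L M S b A)"
  unfolding compressible_type_def
proof (intro conjI tp_complete allI ballI)
  fix m \<phi> assume \<phi>: "\<phi> \<in> formulas2 L S m"
  let ?p = "tp L M S b A"
  obtain a0 where a0: "a0 \<in> A" using assms(2) by blast
  have "definable L M (Inl ` S \<union> range Inr) (\<lambda>v. sat M v [] \<phi>)"
    using \<phi> formulas2_subset by (intro definable_sat) blast
  from compressibleD[OF assms(1) this]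
  obtain Q where "definable L M (Inl ` S \<union> range (Inr :: nat \<Rightarrow> _)) Q" and
    Q: "\<forall>G. finite G \<longrightarrow> (\<forall>a\<in>G. range a \<subseteq> A) \<longrightarrow>
      (\<exists>c. range c \<subseteq> A \<and> Q (case_sum b c) \<and>
        (\<forall>v. Q (case_sum v c) \<longrightarrow> (\<forall>a\<in>G. sat M (case_sum v a) [] \<phi> \<longleftrightarrow> sat M (case_sum b a) [] \<phi>)))"
    by (elim exE conjE)
  then obtain \<psi> where \<psi>: "\<psi> \<in> formulas L (Inl ` S \<union> range Inr)" "\<And>v. sat M v [] \<psi> \<longleftrightarrow> Q v"
    unfolding definable_def by blast
  obtain k where k: "\<psi> \<in> formulas2 L S k" using \<psi>(1) by (rule formulas_eq_formulas2)
  show "\<exists>k. \<exists>\<psi>\<in>formulas2 L S k. \<forall>A\<^sub>0. finite A\<^sub>0 \<and> A\<^sub>0 \<subseteq> A \<longrightarrow>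
        (\<exists>c\<in>tuples A k. inst_fm c \<psi> \<in> ?p \<and>
          implies (name_elements M) (inst_fm c \<psi>)
            ({inst_fm a \<phi> | a. a \<in> tuples A\<^sub>0 m \<and> inst_fm a \<phi> \<in> ?p} \<union>
             {Neg (inst_fm a \<phi>) | a. a \<in> tuples A\<^sub>0 m \<and> Neg (inst_fm a \<phi>) \<in> ?p}))"
  proof (intro exI[of _ k] bexI[OF _ k] allI impI)
    fix A\<^sub>0 assume A\<^sub>0: "finite A\<^sub>0 \<and> A\<^sub>0 \<subseteq> A"
    define ext where "ext l n = (if n < m then l ! n else a0)" for l n
    have fin: "finite (ext ` tuples A\<^sub>0 m)"
      using finite_lists_length_eq[of A\<^sub>0 m] A\<^sub>0 by (simp add: tuples_def conj_commute)
    have "range (ext l) \<subseteq> A" if "l \<in> tuples A\<^sub>0 m" for l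
    proof -
      have "set l \<subseteq> A" "length l = m" using that A\<^sub>0 by (auto simp: tuples_def)
      then show ?thesis using a0 by (auto simp: ext_def)
    qed
    then have "\<forall>a\<in>ext ` tuples A\<^sub>0 m. range a \<subseteq> A" by blast
    from Q[THEN spec, THEN mp, THEN mp, OF fin this]
    obtain c where c: "range c \<subseteq> A" "Q (case_sum b c)"
      and "\<forall>v. Q (case_sum v c) \<longrightarrow> (\<forall>a\<in>ext ` tuples A\<^sub>0 m.
        sat M (case_sum v a) [] \<phi> \<longleftrightarrow> sat M (case_sum b a) [] \<phi>)"
      by (elim exE conjE)
    then have imp: "Q (case_sum v c) \<Longrightarrow> l \<in> tuples A\<^sub>0 m \<Longrightarrow>
        sat M (case_sum v (ext l)) [] \<phi> \<longleftrightarrow> sat M (case_sum b (ext l)) [] \<phi>" for v l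
      by blast
    define l where "l = map c [0..<k]"
    have l: "l \<in> tuples A k" using c(1) by (auto simp: l_def tuples_def)
    have Ql: "sat (name_elements M) v [] (inst_fm l \<psi>) \<longleftrightarrow> Q (case_sum v c)" for v
      unfolding \<psi>(2)[symmetric] sat_inst_fm by (rule sat_formulas2_cong[OF k]) (auto simp: l_def)
    have sat_ext: "sat (name_elements M) v [] (inst_fm l \<phi>) \<longleftrightarrow> sat M (case_sum v (ext l)) [] \<phi>" for v l
      unfolding sat_inst_fm by (rule sat_formulas2_cong[OF \<phi>]) (auto simp: ext_def)
    show "\<exists>c\<in>tuples A k. inst_fm c \<psi> \<in> ?p \<and>
          implies (name_elements M) (inst_fm c \<psi>)
            ({inst_fm a \<phi> | a. a \<in> tuples A\<^sub>0 m \<and> inst_fm a \<phi> \<in> ?p} \<union>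
             {Neg (inst_fm a \<phi>) | a. a \<in> tuples A\<^sub>0 m \<and> Neg (inst_fm a \<phi>) \<in> ?p})"
    proof (intro bexI[OF _ l] conjI)
      show "inst_fm l \<psi> \<in> ?p"
        using inst_fm_in_formulas[OF k l] c(2) by (simp add: tp_def Ql)
    qed (use imp in \<open>auto simp: implies_def tp_def Ql sat_ext\<close>)
  qed
qed

text \<open>Over the empty set only the empty parameter tuple exists. For \<open>m = 0\<close> the
  truth at \<open>b\<close> decides between \<open>\<phi>\<close> and its negation; for
  \<open>m > 0\<close> there is no instance to imply.\<close>

lemma compressible_type_empty: "compressible_type L M S {} (tp L M S b {})"
  unfolding compressible_type_def
proof (intro conjI tp_complete allI ballI)
  fix m \<phi> assume \<phi>: "\<phi> \<in> formulas2 L S m"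
  let ?p = "tp L M S b {}"
  define \<psi> where "\<psi> = (if m = 0 then if sat M (case_sum b (nth [])) [] \<phi> then \<phi> else Neg \<phi>
    else Exists (Eq (Bound 0) (Bound 0)))"
  have \<psi>: "\<psi> \<in> formulas2 L S 0" using \<phi> by (auto simp: \<psi>_def formulas2_def formulas_def)
  have Nil: "[] \<in> tuples {} 0" by (simp add: tuples_def)
  have tup: "tuples {} m = (if m = 0 then {[]} else {})" by (auto simp: tuples_def)
  show "\<exists>k. \<exists>\<psi>\<in>formulas2 L S k. \<forall>A\<^sub>0. finite A\<^sub>0 \<and> A\<^sub>0 \<subseteq> {} \<longrightarrow>
        (\<exists>c\<in>tuples {} k. inst_fm c \<psi> \<in> ?p \<and>
          implies (name_elements M) (inst_fm c \<psi>)
            ({inst_fm a \<phi> | a. a \<in> tuples A\<^sub>0 m \<and> inst_fm a \<phi> \<in> ?p} \<union>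
             {Neg (inst_fm a \<phi>) | a. a \<in> tuples A\<^sub>0 m \<and> Neg (inst_fm a \<phi>) \<in> ?p}))"
  proof (intro exI[of _ 0] bexI[OF _ \<psi>] allI impI bexI[OF _ Nil] conjI)
    show "inst_fm [] \<psi> \<in> ?p"
      using inst_fm_in_formulas[OF \<psi> Nil] by (auto simp: tp_def sat_inst_fm \<psi>_def)
    show "implies (name_elements M) (inst_fm [] \<psi>)
            ({inst_fm a \<phi> | a. a \<in> tuples A\<^sub>0 m \<and> inst_fm a \<phi> \<in> ?p} \<union>
             {Neg (inst_fm a \<phi>) | a. a \<in> tuples A\<^sub>0 m \<and> Neg (inst_fm a \<phi>) \<in> ?p})"
      if "finite A\<^sub>0 \<and> A\<^sub>0 \<subseteq> {}" for A\<^sub>0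
      using that tup by (auto simp: implies_def tp_def sat_inst_fm \<psi>_def)
  qed
qed

section \<open>Obstructions to compressibility\<close>

definition inc :: "nat \<Rightarrow> nat \<Rightarrow> (nat \<Rightarrow> nat) \<Rightarrow> bool" where
  "inc k n h \<longleftrightarrow> strict_mono h \<and> (\<forall>j<k. h j < n)"

lemma inc_comp: "inc k n g \<Longrightarrow> inc n N h \<Longrightarrow> inc k N (h \<circ> g)"
  by (auto simp: inc_def strict_mono_def)

lemma inc_id: "k \<le> n \<Longrightarrow> inc k n id"
  by (auto simp: inc_def strict_mono_def)

text \<open>The semantic counterpart of listing which entries of the two sequences occur in
  \<open>Q\<close>; the point \<open>y\<close> is unrestricted.\<close>

definition dep :: "nat set \<Rightarrow> nat set \<Rightarrow> ('w \<Rightarrow> (nat \<Rightarrow> 't) \<Rightarrow> (nat \<Rightarrow> 't) \<Rightarrow> bool) \<Rightarrow> bool" where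
  "dep S R Q \<longleftrightarrow> (\<forall>y a c a' c'. (\<forall>j\<in>S. a j = a' j) \<longrightarrow> (\<forall>j\<in>R. c j = c' j) \<longrightarrow> Q y a c = Q y a' c')"

lemma depI:
  assumes "\<And>y a c a' c'. (\<And>j. j \<in> S \<Longrightarrow> a j = a' j) \<Longrightarrow> (\<And>j. j \<in> R \<Longrightarrow> c j = c' j) \<Longrightarrow> Q y a c \<Longrightarrow> Q y a' c'"
  shows "dep S R Q"
  unfolding dep_def by (intro allI impI iffI; rule assms) (auto simp: eq_commute)

lemma depD:
  assumes "dep S R Q" "\<And>j. j \<in> S \<Longrightarrow> a j = a' j" "\<And>j. j \<in> R \<Longrightarrow> c j = c' j"
  shows "Q y a c = Q y a' c'"
  using assms unfolding dep_def by blast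

lemma dep_mono: "dep S R Q \<Longrightarrow> S \<subseteq> S' \<Longrightarrow> R \<subseteq> R' \<Longrightarrow> dep S' R' Q"
  unfolding dep_def by blast

lemma dep_imp: "dep S R Q \<Longrightarrow> dep S R Q' \<Longrightarrow> dep S R (\<lambda>y a c. Q y a c \<longrightarrow> Q' y a c)"
  unfolding dep_def by blast

text \<open>Past \<open>card H\<close> the values continue with \<open>N + j\<close>, which keeps
  the map strictly increasing when \<open>H\<close> lies below \<open>N\<close>.\<close>

definition enum_set :: "nat \<Rightarrow> nat set \<Rightarrow> nat \<Rightarrow> nat" where
  "enum_set N H j = (if j < card H then sorted_list_of_set H ! j else N + j)"

lemma inc_enum_set:
  assumes "H \<subseteq> {..<N}"
  shows "inc (card H) N (enum_set N H)"
proof -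
  have fin: "finite H" using assms finite_subset by blast
  have *: "sorted_list_of_set H ! j < N" if "j < card H" for j
    using assms fin that nth_mem[of j "sorted_list_of_set H"] by auto
  have "strict_mono (enum_set N H)"
    unfolding strict_mono_def
  proof (intro allI impI)
    fix i j :: nat assume "i < j"
    then show "enum_set N H i < enum_set N H j"
      using *[of i] fin sorted_wrt_nth_less[OF strict_sorted_list_of_set, of i j H]
      by (auto simp: enum_set_def)
  qed
  then show ?thesis using * by (auto simp: inc_def enum_set_def)
qed

lemma enum_set_image: "finite H \<Longrightarrow> enum_set N H ` {..<card H} = H"
proof -
  assume "finite H"
  then have "H = set (sorted_list_of_set H)" by simp
  also have "\<dots> = (!) (sorted_list_of_set H) ` {..<card H}"
    by (auto simp: in_set_conv_nth simp del: set_sorted_list_of_set)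
  finally show ?thesis by (simp add: enum_set_def cong: image_cong_simp)
qed

lemma enum_set_strict_mono_image:
  assumes "strict_mono h" "j < k"
  shows "enum_set N (h ` {..<k}) j = h j"
proof -
  have inj: "inj_on h {..<k}"
    using assms(1) strict_mono_imp_inj_on inj_on_subset by blast
  have "sorted_list_of_set (h ` {..<k}) = map h [0..<k]"
  proof (rule sorted_list_of_set_unique[THEN iffD1, rotated])
    have "strict_sorted (map h [0..<k])"
      using assms(1) by (auto simp: sorted_wrt_iff_nth_less strict_mono_def)
    then show "strict_sorted (map h [0..<k]) \<and> set (map h [0..<k]) = h ` {..<k} \<and>
        length (map h [0..<k]) = card (h ` {..<k})"
      by (auto simp: card_image[OF inj])
  qed auto
  then show ?thesis
    using assms(2) by (simp add: enum_set_def card_image[OF inj])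
qed

definition hold :: "nat \<Rightarrow> ((nat \<Rightarrow> 't) \<Rightarrow> (nat \<Rightarrow> 't) \<Rightarrow> bool) \<Rightarrow> nat \<Rightarrow> (nat \<Rightarrow> 't) \<Rightarrow> (nat \<Rightarrow> 't) \<Rightarrow> bool" where
  "hold k P n a c \<longleftrightarrow> (\<forall>h. inc k n h \<longrightarrow> P (a \<circ> h) (c \<circ> h))"

lemma hold_sub: "hold k P N a c \<Longrightarrow> inc n N g \<Longrightarrow> hold k P n (a \<circ> g) (c \<circ> g)"
  unfolding hold_def using inc_comp by (metis comp_assoc)

lemma hold_less: "hold k P N a c \<Longrightarrow> n \<le> N \<Longrightarrow> hold k P n a c"
  using hold_sub[OF _ inc_id] by fastforce

lemma hold_at: "hold k P n a c \<Longrightarrow> k \<le> n \<Longrightarrow> P a c"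
  unfolding hold_def using inc_id by fastforce

text \<open>Ramsey's theorem for the colouring of \<open>k\<close>-sets by the truth of
  \<open>P\<close> on their increasing enumeration. The bound \<open>N\<close> does not depend on
  the sequences.\<close>

lemma ramsey_hold:
  assumes supp: "\<And>a c a' c'. (\<And>j. j < k \<Longrightarrow> a j = a' j) \<Longrightarrow> (\<And>j. j < k \<Longrightarrow> c j = c' j) \<Longrightarrow> P a c \<Longrightarrow> P a' c'"
  shows "\<exists>N. \<forall>a c. \<exists>g. inc n N g \<and>
    (hold k P n (a \<circ> g) (c \<circ> g) \<or> hold k (\<lambda>a c. \<not> P a c) n (a \<circ> g) (c \<circ> g))"
proof -
  obtain N :: nat where N: "partn_lst {..<N} [n,n] k"
    using ramsey_full by blast
  show ?thesis
  proof (rule exI[of _ N], intro allI)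
    fix a c :: "nat \<Rightarrow> 'a"
    define f where "f H = (if P (a \<circ> enum_set N H) (c \<circ> enum_set N H) then 0 else 1 :: nat)" for H
    have "f \<in> nsets {..<N} k \<rightarrow> {..<length [n,n]}" by (auto simp: f_def)
    then obtain i G where "G \<in> nsets {..<N} ([n,n]!i)" and i: "i < 2"
      and mono: "f ` nsets G k \<subseteq> {i}"
      using N unfolding partn_lst_def monochromatic_def by force
    then have G: "G \<subseteq> {..<N}" "finite G" "card G = n"
      by (auto simp: nsets_def less_2_cases_iff)
    define g where "g = enum_set N G"
    have g: "inc n N g" using inc_enum_set[OF G(1)] G g_def by simp
    have gim: "g ` {..<n} = G" using enum_set_image[OF G(2)] G g_def by simp
    \<comment> \<open>Below \<open>k\<close>, the set selected by \<open>g \<circ> h\<close> is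
      enumerated by \<open>g \<circ> h\<close> itself, and \<open>P\<close> looks no
      further.\<close>
    have *: "P (a \<circ> g \<circ> h) (c \<circ> g \<circ> h) \<longleftrightarrow> i = 0" if h: "inc k n h" for h
    proof -
      have gh: "strict_mono (g \<circ> h)"
        using g h by (auto simp: inc_def strict_mono_def)
      define H where "H = (g \<circ> h) ` {..<k}"
      have "H \<in> nsets G k"
        using gim h card_image[OF inj_on_subset[OF strict_mono_imp_inj_on[OF gh] subset_UNIV], of "{..<k}"]
        by (auto simp: inc_def nsets_def H_def)
      then have "f H = i" using mono by blast
      moreover have "enum_set N H j = g (h j)" if "j < k" for j
        using enum_set_strict_mono_image[OF gh that] H_def by simp
      then have "P (a \<circ> enum_set N H) (c \<circ> enum_set N H) \<longleftrightarrow> P (a \<circ> g \<circ> h) (c \<circ> g \<circ> h)"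
        using supp[of "a \<circ> enum_set N H" "a \<circ> g \<circ> h" "c \<circ> enum_set N H" "c \<circ> g \<circ> h"]
          supp[of "a \<circ> g \<circ> h" "a \<circ> enum_set N H" "c \<circ> g \<circ> h" "c \<circ> enum_set N H"] by auto
      ultimately show ?thesis by (auto simp: f_def split: if_splits)
    qed
    show "\<exists>g. inc n N g \<and>
        (hold k P n (a \<circ> g) (c \<circ> g) \<or> hold k (\<lambda>a c. \<not> P a c) n (a \<circ> g) (c \<circ> g))"
      using g * by (intro exI[of _ g]) (cases "i = 0"; auto simp: hold_def)
  qed
qed

text \<open>The entries below \<open>p\<close> are already fixed, while the tail \<open>E\<close> is
  still to be chosen.\<close>

definition mix :: "nat \<Rightarrow> (nat \<Rightarrow> 't) \<Rightarrow> (nat \<Rightarrow> 't) \<Rightarrow> nat \<Rightarrow> 't" where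
  "mix p \<alpha> E j = (if j < p then \<alpha> j else E j)"

text \<open>
  \<open>X y x\<close> says that an instance of the formula under consideration, with parameters \<open>x \<in> AA\<close> and
  true at \<open>b\<close>, fails at \<open>y\<close>. By \<open>H\<close>, finitely many of these instances are compressed by one
  instance of \<open>\<psi>\<close>; by \<open>NC\<close>, they are not compressed by any condition in \<open>NN\<close>, the predicates
  that can mention arbitrary constants. The predicates in \<open>QQ\<close> have no constants besides a point and
  two sequences, so that NIP and Ramsey's theorem apply to them.
\<close>

locale obstruction =
  fixes QQ :: "('t \<Rightarrow> (nat \<Rightarrow> 't) \<Rightarrow> (nat \<Rightarrow> 't) \<Rightarrow> bool) set"
    and NN :: "('t \<Rightarrow> (nat \<Rightarrow> 't) \<Rightarrow> bool) set"
    and X \<psi> :: "'t \<Rightarrow> 't \<Rightarrow> bool"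
    and AA CC :: "'t set" and b :: 't
  assumes Q_neg: "Q \<in> QQ \<Longrightarrow> (\<lambda>y a c. \<not> Q y a c) \<in> QQ"
    and Q_conj: "Q \<in> QQ \<Longrightarrow> Q' \<in> QQ \<Longrightarrow> (\<lambda>y a c. Q y a c \<and> Q' y a c) \<in> QQ"
    and Q_ex: "Q \<in> QQ \<Longrightarrow> (\<lambda>y a c. \<exists>y'. Q y' a c) \<in> QQ"
    and Q_ex_upd: "Q \<in> QQ \<Longrightarrow> (\<lambda>y a c. \<exists>u. Q y a (c(m := u))) \<in> QQ"
    and Q_reindex: "Q \<in> QQ \<Longrightarrow> (\<lambda>y a c. Q y (a \<circ> f) (c \<circ> g)) \<in> QQ"
    and Q_X: "(\<lambda>y a c. X y (a j)) \<in> QQ"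
    and Q_psi: "(\<lambda>y a c. \<psi> y (c j)) \<in> QQ"
    and nip: "Q \<in> QQ \<Longrightarrow> \<exists>d. \<forall>(n::nat) a c. (\<forall>I\<subseteq>{..<n}. \<exists>w. \<forall>i<n. Q w (a i) (c i) \<longleftrightarrow> i \<in> I) \<longrightarrow> n \<le> d"
    and nip_meet: "\<exists>d. \<forall>(n::nat) a. (\<forall>I\<subseteq>{..<n}. \<exists>u. \<forall>i<n. (\<exists>y. \<psi> y u \<and> X y (a i)) \<longleftrightarrow> i \<in> I) \<longrightarrow> n \<le> d"
    and N_true: "(\<lambda>y E. True) \<in> NN"
    and N_conj: "N \<in> NN \<Longrightarrow> N' \<in> NN \<Longrightarrow> (\<lambda>y E. N y E \<and> N' y E) \<in> NN"
    and N_inst: "Q \<in> QQ \<Longrightarrow> range \<alpha> \<subseteq> AA \<Longrightarrow> range c \<subseteq> CC \<Longrightarrow> (\<lambda>y E. Q y (mix p \<alpha> E) c) \<in> NN"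
    and NC: "N \<in> NN \<Longrightarrow> \<exists>M. finite M \<and> M \<subseteq> AA \<and>
      (\<forall>E. range E \<subseteq> AA \<longrightarrow> N b E \<longrightarrow> (\<exists>x\<in>M. \<exists>y. X y x \<and> N y E))"
    and H: "finite M \<Longrightarrow> M \<subseteq> AA \<Longrightarrow> \<exists>c\<in>CC. \<psi> b c \<and> (\<forall>x\<in>M. \<forall>y. \<psi> y c \<longrightarrow> \<not> X y x)"
    and AA_nonempty: "AA \<noteq> {}"
begin

text \<open>This says that \<open>\<psi>(y,u)\<close> does not imply the instance with parameter
  \<open>x\<close>; it is the relation bounded by \<open>nip_meet\<close>.\<close>

definition Z where "Z u x \<longleftrightarrow> (\<exists>y. \<psi> y u \<and> X y x)"

lemma N_Ball: "finite S \<Longrightarrow> (\<And>s. s \<in> S \<Longrightarrow> N s \<in> NN) \<Longrightarrow> (\<lambda>y E. \<forall>s\<in>S. N s y E) \<in> NN"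
proof (induction S rule: finite_induct)
  case empty
  then show ?case using N_true by simp
next
  case (insert x F)
  then show ?case using N_conj[of "N x" "\<lambda>y E. \<forall>s\<in>F. N s y E"] by simp
qed

lemma Q_true: "(\<lambda>y a c. True) \<in> QQ"
  using Q_neg[OF Q_conj[OF Q_X[of 0] Q_neg[OF Q_X[of 0]]]] by simp

lemma Q_Ball: "finite S \<Longrightarrow> (\<And>s. s \<in> S \<Longrightarrow> Q s \<in> QQ) \<Longrightarrow> (\<lambda>y a c. \<forall>s\<in>S. Q s y a c) \<in> QQ"
proof (induction S rule: finite_induct)
  case empty
  then show ?case using Q_true by simp
next
  case (insert x F)
  then show ?case using Q_conj[of "Q x" "\<lambda>y a c. \<forall>s\<in>F. Q s y a c"] by simp
qed

lemma Q_Z: "(\<lambda>y a c. Z (c m) (a j)) \<in> QQ"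
  unfolding Z_def using Q_ex[OF Q_conj[OF Q_psi[of m] Q_X[of j]]] by simp

definition W where
  "W m T Q y a c \<longleftrightarrow> (\<exists>u. \<psi> y u \<and> (\<forall>t\<in>T. Z u (a t)) \<and> Q y a (c(m := u)))"

lemma Q_W:
  assumes "Q \<in> QQ" "finite T"
  shows "W m T Q \<in> QQ"
proof -
  have "(\<lambda>y a c. \<psi> y (c m) \<and> (\<forall>t\<in>T. Z (c m) (a t)) \<and> Q y a c) \<in> QQ"
    by (intro Q_conj Q_psi Q_Ball Q_Z assms)
  from Q_ex_upd[OF this, of m] show ?thesis
    by (simp add: W_def[abs_def])
qed

text \<open>Quantifying over \<open>u\<close> frees the condition from the entry \<open>c m\<close>,
  while the tests by \<open>Z\<close> bring in the entries of \<open>a\<close> at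
  \<open>T\<close>.\<close>

lemma dep_W: "dep S (insert m R) Q \<Longrightarrow> dep (S \<union> T) R (W m T Q)"
proof (rule depI)
  fix y a c a' c'
  assume Q: "dep S (insert m R) Q"
    and eq: "\<And>j. j \<in> S \<union> T \<Longrightarrow> a j = a' j" "\<And>j. j \<in> R \<Longrightarrow> c j = c' j"
    and "W m T Q y a c"
  then obtain u where "\<psi> y u" "\<forall>t\<in>T. Z u (a t)" "Q y a (c(m := u))"
    unfolding W_def by blast
  moreover have "Q y a (c(m := u)) = Q y a' (c'(m := u))"
    by (rule depD[OF Q]) (use eq in auto)
  ultimately show "W m T Q y a' c'" using eq unfolding W_def by auto
qed

section \<open>Construction of good sequences\<close>

text \<open>A condition tested at \<open>t\<close> may mention later entries of \<open>a\<close>,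
  but no \<open>c j\<close> with \<open>j \<ge> t\<close>. Hence \<open>c p\<close> is fixed first,
  the tail is built by induction for all candidate prefixes at once, and only then is
  \<open>a p\<close> selected. This is possible because the selection is confined to a finite set
  known in advance, whose instances \<open>c p\<close> and all later entries of \<open>c\<close>
  compress.\<close>

lemma sequence_aux:
  assumes "finite \<Delta>" "\<Delta> \<subseteq> QQ"
  shows "finite PP \<Longrightarrow> (\<And>\<alpha>. \<alpha> \<in> PP \<Longrightarrow> range \<alpha> \<subseteq> AA) \<Longrightarrow> range c \<subseteq> CC \<Longrightarrow> finite M \<Longrightarrow> M \<subseteq> AA \<Longrightarrow>
    \<exists>a' c'. range a' \<subseteq> AA \<and> range c' \<subseteq> CC \<and> (\<forall>j<p. c' j = c j) \<and>
      (\<forall>j\<in>{p..<p+n}. \<psi> b (c' j) \<and> (\<forall>x\<in>M \<union> a' ` {p..j}. \<forall>y. \<psi> y (c' j) \<longrightarrow> \<not> X y x)) \<and>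
      (\<forall>\<alpha>\<in>PP. \<forall>t\<in>{p..<p+n}. \<forall>Q\<in>\<Delta>. dep (-{t}) {..<t} Q \<longrightarrow> Q b (mix p \<alpha> a') c' \<longrightarrow>
        (\<exists>y. X y (a' t) \<and> Q y (mix p \<alpha> a') c'))"
proof (induction n arbitrary: p PP c M)
  case 0
  obtain x where "x \<in> AA" using AA_nonempty by blast
  then show ?case using 0 by (intro exI[of _ "\<lambda>_. x"] exI[of _ c]) auto
next
  case (Suc n)
  define \<Gamma> where "\<Gamma> = {(Q, \<alpha>). Q \<in> \<Delta> \<and> \<alpha> \<in> PP \<and> dep (-{p}) {..<p} Q}"
  have "\<Gamma> \<subseteq> \<Delta> \<times> PP" by (auto simp: \<Gamma>_def)
  then have fin\<Gamma>: "finite \<Gamma>" using assms(1) Suc.prems(1) by (meson finite_SigmaI finite_subset)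
  \<comment> \<open>All conditions true at \<open>b\<close> must survive with the same
    \<open>a p\<close>, so they are conjoined. Which ones are true depends on the tail, so every
    subset \<open>S\<close> is prepared for.\<close>
  define NS where "NS S = (\<lambda>y E. \<forall>s\<in>S. (fst s) y (mix p (snd s) E) c)"
    for S :: "(('t \<Rightarrow> (nat \<Rightarrow> 't) \<Rightarrow> (nat \<Rightarrow> 't) \<Rightarrow> bool) \<times> (nat \<Rightarrow> 't)) set"
  have "NS S \<in> NN" if "S \<subseteq> \<Gamma>" for S
    unfolding NS_def
  proof (intro N_Ball N_inst)
    fix s assume "s \<in> S"
    then have "s \<in> \<Gamma>" using that by blast
    then have "fst s \<in> \<Delta>" "snd s \<in> PP" by (auto simp: \<Gamma>_def)
    then show "fst s \<in> QQ" "range (snd s) \<subseteq> AA"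
      using assms(2) Suc.prems(2)[of "snd s"] by blast+
  qed (use finite_subset[OF that fin\<Gamma>] Suc.prems(3) in auto)
  then have "\<forall>S\<in>Pow \<Gamma>. \<exists>M. finite M \<and> M \<subseteq> AA \<and>
      (\<forall>E. range E \<subseteq> AA \<longrightarrow> NS S b E \<longrightarrow> (\<exists>x\<in>M. \<exists>y. X y x \<and> NS S y E))"
    using NC by blast
  then obtain MS where "\<forall>S\<in>Pow \<Gamma>. finite (MS S) \<and> MS S \<subseteq> AA \<and>
      (\<forall>E. range E \<subseteq> AA \<longrightarrow> NS S b E \<longrightarrow> (\<exists>x\<in>MS S. \<exists>y. X y x \<and> NS S y E))"
    by (rule bchoice[THEN exE])
  then have MS: "\<And>S. S \<subseteq> \<Gamma> \<Longrightarrow> finite (MS S)" "\<And>S. S \<subseteq> \<Gamma> \<Longrightarrow> MS S \<subseteq> AA"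
      "\<And>S E. S \<subseteq> \<Gamma> \<Longrightarrow> range E \<subseteq> AA \<Longrightarrow> NS S b E \<Longrightarrow> (\<exists>x\<in>MS S. \<exists>y. X y x \<and> NS S y E)"
    by auto
  \<comment> \<open>The candidates for \<open>a p\<close>, whatever the tail will be.\<close>
  define M1 where "M1 = (\<Union>S\<in>Pow \<Gamma>. MS S)"
  have M1: "finite M1" "M1 \<subseteq> AA" using MS fin\<Gamma> by (auto simp: M1_def)
  obtain cp where cp: "cp \<in> CC" "\<psi> b cp" "\<forall>x\<in>M \<union> M1. \<forall>y. \<psi> y cp \<longrightarrow> \<not> X y x"
    using H[of "M \<union> M1"] M1 Suc.prems by auto
  define PP1 where "PP1 = (\<lambda>(\<alpha>, x). \<alpha>(p := x)) ` (PP \<times> M1)"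
  have "\<exists>a' c'. range a' \<subseteq> AA \<and> range c' \<subseteq> CC \<and> (\<forall>j<Suc p. c' j = (c(p := cp)) j) \<and>
      (\<forall>j\<in>{Suc p..<Suc p+n}. \<psi> b (c' j) \<and> (\<forall>x\<in>(M \<union> M1) \<union> a' ` {Suc p..j}. \<forall>y. \<psi> y (c' j) \<longrightarrow> \<not> X y x)) \<and>
      (\<forall>\<alpha>\<in>PP1. \<forall>t\<in>{Suc p..<Suc p+n}. \<forall>Q\<in>\<Delta>. dep (-{t}) {..<t} Q \<longrightarrow> Q b (mix (Suc p) \<alpha> a') c' \<longrightarrow>
        (\<exists>y. X y (a' t) \<and> Q y (mix (Suc p) \<alpha> a') c'))"
  proof (rule Suc.IH)
    show "finite PP1" using M1 Suc.prems by (auto simp: PP1_def)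
    show "range \<alpha> \<subseteq> AA" if "\<alpha> \<in> PP1" for \<alpha>
      using that M1 Suc.prems(2) by (fastforce simp: PP1_def)
    show "range (c(p := cp)) \<subseteq> CC" using Suc.prems(3) cp by auto
  qed (use M1 Suc.prems in auto)
  then obtain a1 c1 where IH: "range a1 \<subseteq> AA \<and> range c1 \<subseteq> CC \<and> (\<forall>j<Suc p. c1 j = (c(p := cp)) j) \<and>
      (\<forall>j\<in>{Suc p..<Suc p+n}. \<psi> b (c1 j) \<and> (\<forall>x\<in>(M \<union> M1) \<union> a1 ` {Suc p..j}. \<forall>y. \<psi> y (c1 j) \<longrightarrow> \<not> X y x)) \<and>
      (\<forall>\<alpha>\<in>PP1. \<forall>t\<in>{Suc p..<Suc p+n}. \<forall>Q\<in>\<Delta>. dep (-{t}) {..<t} Q \<longrightarrow> Q b (mix (Suc p) \<alpha> a1) c1 \<longrightarrow>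
        (\<exists>y. X y (a1 t) \<and> Q y (mix (Suc p) \<alpha> a1) c1))"
    by (elim exE)
  then have a1: "range a1 \<subseteq> AA" and c1: "range c1 \<subseteq> CC"
    and c1_eq: "\<And>j. j < Suc p \<Longrightarrow> c1 j = (c(p := cp)) j"
    by auto
  have psi1: "\<psi> b (c1 j)" and miss1: "x\<in>(M \<union> M1) \<union> a1 ` {Suc p..j} \<Longrightarrow> \<psi> y (c1 j) \<Longrightarrow> \<not> X y x"
    if "j\<in>{Suc p..<Suc p+n}" for j x y
    using IH that by blast+
  have hit1: "\<exists>y. X y (a1 t) \<and> Q y (mix (Suc p) \<alpha> a1) c1"
    if "\<alpha>\<in>PP1" "t\<in>{Suc p..<Suc p+n}" "Q\<in>\<Delta>" "dep (-{t}) {..<t} Q" "Q b (mix (Suc p) \<alpha> a1) c1" for \<alpha> t Q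
    using IH that by blast
  define S where "S = {s \<in> \<Gamma>. (fst s) b (mix p (snd s) a1) c}"
  have S: "S \<subseteq> \<Gamma>" by (auto simp: S_def)
  have "NS S b a1" by (auto simp: NS_def S_def)
  then obtain x y0 where x: "x \<in> MS S" "X y0 x" "NS S y0 a1" using MS(3)[OF S a1] by blast
  have xM1: "x \<in> M1" using x(1) S by (auto simp: M1_def)
  define a2 where "a2 = a1(p := x)"
  have mix_eq: "mix (Suc p) (\<alpha>(p := x)) a1 = mix p \<alpha> a2" for \<alpha>
    by (auto simp: mix_def a2_def fun_eq_iff)
  show ?case
  proof (rule exI[of _ a2], rule exI[of _ c1], intro conjI ballI impI allI)
    show "range a2 \<subseteq> AA" using a1 xM1 M1 by (auto simp: a2_def)
    show "range c1 \<subseteq> CC" by (rule c1)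
    show "c1 j = c j" if "j < p" for j using c1_eq that by simp
    show "\<psi> b (c1 j)" if "j \<in> {p..<p + Suc n}" for j
      using psi1[of j] c1_eq[of p] cp that by (cases "j = p") auto
    show "\<not> X y z" if "j \<in> {p..<p + Suc n}" "z \<in> M \<union> a2 ` {p..j}" "\<psi> y (c1 j)" for j z y
    proof (cases "j = p")
      case True
      then show ?thesis using that cp c1_eq[of p] xM1 by (auto simp: a2_def)
    next
      case False
      then have "z \<in> M \<union> M1 \<union> a1 ` {Suc p..j}"
        using that xM1 by (auto simp: a2_def not_less_eq_eq[symmetric] le_Suc_eq split: if_splits)
      then show ?thesis using miss1[of j z y] that False by auto
    qed
    fix \<alpha> t Q
    assume \<alpha>: "\<alpha> \<in> PP" and t: "t \<in> {p..<p + Suc n}" and Q: "Q \<in> \<Delta>" "dep (-{t}) {..<t} Q"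
      and Qb: "Q b (mix p \<alpha> a2) c1"
    show "\<exists>y. X y (a2 t) \<and> Q y (mix p \<alpha> a2) c1"
    proof (cases "t = p")
      case True
      \<comment> \<open>\<open>Q\<close> sees neither the entry \<open>p\<close> of \<open>a\<close>
        nor the entries of \<open>c\<close> from \<open>p\<close> on, and nothing else
        differs.\<close>
      have eq: "Q y (mix p \<alpha> a2) c1 = Q y (mix p \<alpha> a1) c" for y
        by (rule depD[OF Q(2)]) (auto simp: mix_def a2_def True c1_eq)
      have "(Q, \<alpha>) \<in> S" using Q \<alpha> Qb True eq by (auto simp: S_def \<Gamma>_def)
      then have "Q y0 (mix p \<alpha> a1) c" using x(3) by (auto simp: NS_def)
      then show ?thesis using eq x(2) True by (auto simp: a2_def)
    next
      case False
      then have "t \<in> {Suc p..<Suc p+n}" using t by auto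
      moreover have "\<alpha>(p := x) \<in> PP1" using \<alpha> xM1 by (auto simp: PP1_def)
      ultimately show ?thesis
        using hit1[of "\<alpha>(p := x)" t Q] Q Qb False unfolding mix_eq by (simp add: a2_def)
    qed
  qed
qed

definition admissible where
  "admissible D \<longleftrightarrow> finite D \<and> (\<forall>(k, Q)\<in>D. Q \<in> QQ \<and> dep {..<k} {..<k} Q)"

text \<open>Quantifying over all selections \<open>h\<close> makes goodness pass to subsequences, as
  is required for combining it with Ramsey's theorem.\<close>

definition Good where
  "Good D n a c \<longleftrightarrow> range a \<subseteq> AA \<and> range c \<subseteq> CC \<and>
    (\<forall>j<n. \<psi> b (c j) \<and> (\<forall>i\<le>j. \<not> Z (c j) (a i))) \<and>
    (\<forall>(k, Q)\<in>D. \<forall>h t. inc k n h \<longrightarrow> t < k \<longrightarrow> dep (-{t}) {..<t} Q \<longrightarrow>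
      Q b (a \<circ> h) (c \<circ> h) \<longrightarrow> (\<exists>y. X y (a (h t)) \<and> Q y (a \<circ> h) (c \<circ> h)))"

lemma Good_sub:
  assumes "Good D N a c" "inc n N g"
  shows "Good D n (a \<circ> g) (c \<circ> g)"
proof -
  have g: "\<And>i j. i \<le> j \<Longrightarrow> g i \<le> g j" "\<And>j. j < n \<Longrightarrow> g j < N"
    using assms(2) by (auto simp: inc_def strict_mono_less_eq)
  have "\<exists>y. X y ((a \<circ> g) (h t)) \<and> Q y (a \<circ> g \<circ> h) (c \<circ> g \<circ> h)"
    if "(k, Q) \<in> D" "inc k n h" "t < k" "dep (-{t}) {..<t} Q" "Q b (a \<circ> g \<circ> h) (c \<circ> g \<circ> h)"
    for k Q h t
    using assms(1) that inc_comp[OF that(2) assms(2)] unfolding Good_def comp_assoc by fastforce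
  moreover have "range (a \<circ> g) \<subseteq> AA" "range (c \<circ> g) \<subseteq> CC"
    "\<forall>j<n. \<psi> b ((c \<circ> g) j) \<and> (\<forall>i\<le>j. \<not> Z ((c \<circ> g) j) ((a \<circ> g) i))"
    using assms(1) g unfolding Good_def by auto
  ultimately show ?thesis unfolding Good_def by blast
qed

lemma Good_antimono: "Good D n a c \<Longrightarrow> D' \<subseteq> D \<Longrightarrow> Good D' n a c"
  unfolding Good_def by blast

lemma Good_exists:
  assumes "admissible D"
  shows "\<exists>a c. Good D n a c"
proof -
  obtain x where x: "x \<in> AA" using AA_nonempty by blast
  obtain c0 where c0: "c0 \<in> CC" using H[of "{}"] by auto
  \<comment> \<open>Selections matter only below \<open>k\<close>; with the value 0 beyond, finitely
    many remain, and \<open>sequence_aux\<close> needs a finite \<open>\<Delta>\<close>.\<close>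
  define G where "G k = {h :: nat \<Rightarrow> nat. \<forall>j. (j \<in> {..<k} \<longrightarrow> h j \<in> {..<n}) \<and> (j \<notin> {..<k} \<longrightarrow> h j = 0)}" for k
  have finG: "finite (G k)" for k
    unfolding G_def by (rule finite_set_of_finite_funs) auto
  define \<Delta> where "\<Delta> = (\<lambda>((k, Q), h) y a c. Q y (a \<circ> h) (c \<circ> h)) ` (SIGMA kQ:D. G (fst kQ))"
  have "finite \<Delta>" unfolding \<Delta>_def
    using assms finG by (intro finite_imageI finite_SigmaI) (auto simp: admissible_def)
  moreover have "\<Delta> \<subseteq> QQ"
    using assms by (auto simp: \<Delta>_def admissible_def intro!: Q_reindex)
  ultimately obtain a' c' where a: "range a' \<subseteq> AA" "range c' \<subseteq> CC"
    and psi: "\<forall>j\<in>{0..<n}. \<psi> b (c' j) \<and> (\<forall>x\<in>{} \<union> a' ` {0..j}. \<forall>y. \<psi> y (c' j) \<longrightarrow> \<not> X y x)"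
    and hit: "\<forall>t\<in>{0..<n}. \<forall>Q\<in>\<Delta>. dep (-{t}) {..<t} Q \<longrightarrow> Q b a' c' \<longrightarrow>
        (\<exists>y. X y (a' t) \<and> Q y a' c')"
    using sequence_aux[of \<Delta> "{\<lambda>_. x}" "\<lambda>_. c0" "{}" 0 n] x c0 by (auto simp: mix_def)
  have "Good D n a' c'"
    unfolding Good_def
  proof (intro conjI a)
    show "\<forall>j<n. \<psi> b (c' j) \<and> (\<forall>i\<le>j. \<not> Z (c' j) (a' i))"
      using psi by (auto simp: Z_def)
    have "\<exists>y. X y (a' (h t)) \<and> Q y (a' \<circ> h) (c' \<circ> h)"
      if D: "(k, Q) \<in> D" and h: "inc k n h" and t: "t < k" and Q: "dep (-{t}) {..<t} Q"
        and Qb: "Q b (a' \<circ> h) (c' \<circ> h)" for k Q h t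
    proof -
      define h' where "h' j = (if j < k then h j else 0)" for j
      have supp: "dep {..<k} {..<k} Q" using assms D by (auto simp: admissible_def)
      have eq: "Q y (a \<circ> h') (c \<circ> h') = Q y (a \<circ> h) (c \<circ> h)" for y a c
        by (rule depD[OF supp]) (auto simp: h'_def)
      have "h' \<in> G k" using h by (auto simp: G_def h'_def inc_def)
      then have mem: "(\<lambda>y a c. Q y (a \<circ> h) (c \<circ> h)) \<in> \<Delta>"
        using D unfolding \<Delta>_def eq[symmetric] by force
      \<comment> \<open>A strictly increasing \<open>h\<close> carries the restriction on dependence
        from \<open>t\<close> over to \<open>h t\<close>.\<close>
      have "dep (-{h t}) {..<h t} (\<lambda>y a c. Q y (a \<circ> h) (c \<circ> h))"
      proof (rule depI)
        fix y a c a2 c2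
        assume eq: "\<And>j. j \<in> - {h t} \<Longrightarrow> a j = a2 j" "\<And>j. j \<in> {..<h t} \<Longrightarrow> c j = c2 j"
          and "Q y (a \<circ> h) (c \<circ> h)"
        moreover have "h j \<noteq> h t" if "j \<noteq> t" for j
          using h that strict_mono_eq by (auto simp: inc_def)
        moreover have "h j < h t" if "j < t" for j
          using h that by (auto simp: inc_def strict_mono_def)
        ultimately have "Q y (a \<circ> h) (c \<circ> h) = Q y (a2 \<circ> h) (c2 \<circ> h)"
          by (intro depD[OF Q]) auto
        with \<open>Q y (a \<circ> h) (c \<circ> h)\<close> show "Q y (a2 \<circ> h) (c2 \<circ> h)" by simp
      qed
      moreover have "h t \<in> {0..<n}" using h t by (auto simp: inc_def)
      ultimately show ?thesis using hit mem Qb by blast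
    qed
    then show "\<forall>(k, Q)\<in>D. \<forall>h t. inc k n h \<longrightarrow> t < k \<longrightarrow> dep (-{t}) {..<t} Q \<longrightarrow>
      Q b (a' \<circ> h) (c' \<circ> h) \<longrightarrow> (\<exists>y. X y (a' (h t)) \<and> Q y (a' \<circ> h) (c' \<circ> h))" by blast
  qed
  then show ?thesis by blast
qed

section \<open>Forced conditions and moves\<close>

text \<open>The condition cannot fail homogeneously at \<open>b\<close> on a good sequence. By
  Ramsey's theorem it then holds homogeneously on a subsequence of every long enough sequence that
  is good for a suitable \<open>D\<close>.\<close>

definition forced where
  "forced k P \<longleftrightarrow> (\<exists>D n. admissible D \<and>
    (\<forall>a c. Good D n a c \<longrightarrow> \<not> hold k (\<lambda>a c. \<not> P b a c) n a c))"

text \<open>Ramsey's theorem is applied for one condition after the other; homogeneity already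
  reached survives the passage to a subsequence.\<close>

lemma forced_finite:
  assumes "finite S" "\<And>k P. (k, P) \<in> S \<Longrightarrow> dep {..<k} {..<k} P \<and> forced k P"
  shows "\<exists>D N. admissible D \<and> (\<forall>a c. Good D N a c \<longrightarrow>
    (\<exists>g. inc n N g \<and> (\<forall>(k, P)\<in>S. hold k (P b) n (a \<circ> g) (c \<circ> g))))"
  using assms
proof (induction S arbitrary: n rule: finite_induct)
  case empty
  show ?case
    by (intro exI[of _ "{}"] exI[of _ n]) (auto simp: admissible_def intro!: exI[of _ id] inc_id)
next
  case (insert kP S)
  obtain k P where kP: "kP = (k, P)" by (cases kP)
  have P: "dep {..<k} {..<k} P" "forced k P" using insert.prems kP by auto
  obtain D0 n0 where D0: "admissible D0"
    and n0: "\<And>a c. Good D0 n0 a c \<Longrightarrow> \<not> hold k (\<lambda>a c. \<not> P b a c) n0 a c"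
    using P(2) unfolding forced_def by blast
  \<comment> \<open>Long enough both for the required length \<open>n\<close> and for
    \<open>n0\<close>, where the negation is excluded.\<close>
  define n1 where "n1 = max n n0"
  obtain N1 where N1: "\<And>a c. \<exists>g. inc n1 N1 g \<and>
      (hold k (P b) n1 (a \<circ> g) (c \<circ> g) \<or> hold k (\<lambda>a c. \<not> P b a c) n1 (a \<circ> g) (c \<circ> g))"
  proof -
    have "\<exists>N1. \<forall>a c. \<exists>g. inc n1 N1 g \<and>
      (hold k (P b) n1 (a \<circ> g) (c \<circ> g) \<or> hold k (\<lambda>a c. \<not> P b a c) n1 (a \<circ> g) (c \<circ> g))"
      by (rule ramsey_hold, rule depD[OF P(1), THEN iffD1]) auto
    then show ?thesis using that by blast
  qed
  obtain D N where D: "admissible D" and N: "\<And>a c. Good D N a c \<Longrightarrow>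
    (\<exists>g. inc N1 N g \<and> (\<forall>(k, P)\<in>S. hold k (P b) N1 (a \<circ> g) (c \<circ> g)))"
    using insert.IH[of N1] insert.prems by blast
  show ?case
  proof (intro exI[of _ "D \<union> D0"] exI[of _ N] conjI allI impI)
    show "admissible (D \<union> D0)" using D D0 by (auto simp: admissible_def)
    fix a c assume good: "Good (D \<union> D0) N a c"
    then obtain g where g: "inc N1 N g" "\<forall>(k, P)\<in>S. hold k (P b) N1 (a \<circ> g) (c \<circ> g)"
      using N Good_antimono[OF good, of D] by blast
    obtain g1 where g1: "inc n1 N1 g1" and
      hold: "hold k (P b) n1 (a \<circ> g \<circ> g1) (c \<circ> g \<circ> g1) \<or>
        hold k (\<lambda>a c. \<not> P b a c) n1 (a \<circ> g \<circ> g1) (c \<circ> g \<circ> g1)"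
      using N1 by blast
    have g1': "inc n0 N1 g1" "inc n N1 g1" using g1 by (auto simp: inc_def n1_def)
    have "Good D0 n0 (a \<circ> g \<circ> g1) (c \<circ> g \<circ> g1)"
      using Good_sub[OF Good_sub[OF Good_antimono[OF good] g(1)] g1'(1)] by blast
    then have "\<not> hold k (\<lambda>a c. \<not> P b a c) n1 (a \<circ> g \<circ> g1) (c \<circ> g \<circ> g1)"
      using n0 hold_less by (metis n1_def max.cobounded2)
    then have "hold k (P b) n (a \<circ> g \<circ> g1) (c \<circ> g \<circ> g1)"
      using hold hold_less by (metis n1_def max.cobounded1)
    moreover have "\<forall>(k, P)\<in>S. hold k (P b) n (a \<circ> g \<circ> g1) (c \<circ> g \<circ> g1)"
      using g(2) hold_sub[OF _ g1'(2)] by blast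
    moreover have "inc n N (g \<circ> g1)" using inc_comp[OF g1'(2) g(1)] .
    ultimately show "\<exists>g. inc n N g \<and> (\<forall>(k, P)\<in>insert kP S. hold k (P b) n (a \<circ> g) (c \<circ> g))"
      by (intro exI[of _ "g \<circ> g1"]) (auto simp: kP comp_assoc)
  qed
qed

text \<open>
  \<open>moves p\<close>: \<open>c m\<close>, which avoids \<open>X\<close> at \<open>a t\<close> for all \<open>t \<le> m\<close> by choice of the sequence, can be
  replaced by a \<open>u\<close> meeting \<open>X\<close> at \<open>a t\<close> for \<open>p\<close> prescribed values of \<open>t\<close>, without changing the
  truth of \<open>Q\<close> at \<open>b\<close>.
\<close>

definition moves where
  "moves p \<longleftrightarrow> (\<forall>k q T m Q. Q \<in> QQ \<longrightarrow> T \<subseteq> {q..m} \<longrightarrow> q \<le> m \<longrightarrow> m < k \<longrightarrow> card T = p \<longrightarrow>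
    dep ({..<k} - T) ({..<q} \<union> {m}) Q \<longrightarrow> forced k (\<lambda>y a c. Q y a c \<longrightarrow> W m T Q y a c))"

text \<open>With nothing to meet, \<open>c m\<close> itself serves as \<open>u\<close>, since
  \<open>\<psi> b (c m)\<close> holds on a good sequence.\<close>

lemma moves_0: "moves 0"
  unfolding moves_def
proof (intro allI impI)
  fix k q m :: nat and T Q
  assume "T \<subseteq> {q..m}" "m < k" "card T = 0"
  then have T: "T = {}" using finite_subset by fastforce
  have "\<not> hold k (\<lambda>a c. \<not> (Q b a c \<longrightarrow> W m T Q b a c)) k a c" if "Good {} k a c" for a c
  proof
    assume "hold k (\<lambda>a c. \<not> (Q b a c \<longrightarrow> W m T Q b a c)) k a c"
    then have "Q b a c" "\<not> W m T Q b a c" by (auto dest: hold_at)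
    moreover have "\<psi> b (c m)" using that \<open>m < k\<close> by (auto simp: Good_def)
    ultimately show False unfolding W_def T by (metis fun_upd_triv empty_iff)
  qed
  then show "forced k (\<lambda>y a c. Q y a c \<longrightarrow> W m T Q y a c)"
    unfolding forced_def by (intro exI[of _ "{}"] exI[of _ k]) (auto simp: admissible_def)
qed

text \<open>Otherwise the single entry \<open>c d\<close> can be moved so as to meet exactly the
  instances in any \<open>I \<subseteq> {..d}\<close>: \<open>Q I\<close> preserves the misses
  outside \<open>I\<close>, and it holds before the move because \<open>c d\<close> misses every
  \<open>a i\<close> with \<open>i \<le> d\<close>. This shatters more points than
  \<open>nip_meet\<close> allows.\<close>

lemma not_all_moves: "\<exists>p. \<not> moves p"
proof (rule ccontr)
  assume "\<not> ?thesis"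
  then have moves: "moves p" for p by blast
  obtain d where d: "\<And>(n::nat) a. (\<And>I. I\<subseteq>{..<n} \<Longrightarrow> \<exists>u. \<forall>i<n. Z u (a i) \<longleftrightarrow> i \<in> I) \<Longrightarrow> n \<le> d"
    using nip_meet unfolding Z_def by metis
  define Q where "Q I y a c \<longleftrightarrow> (\<forall>s\<in>{..d} - I. \<not> Z (c d) (a s))" for I :: "nat set" and y :: 't and a c
  define P where "P I y a c \<longleftrightarrow> (Q I y a c \<longrightarrow> W d I (Q I) y a c)" for I y a c
  have QQQ: "Q I \<in> QQ" for I
    unfolding Q_def by (intro Q_Ball Q_neg Q_Z) auto
  have depQ: "dep ({..<Suc d} - I) ({..<0} \<union> {d}) (Q I)" for I
    by (rule depI) (auto simp: Q_def)
  have "dep {..<Suc d} {..<Suc d} (P I) \<and> forced (Suc d) (P I)" if "I \<subseteq> {..d}" for I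
  proof
    have "dep ({..<Suc d} - I \<union> I) {..<0} (W d I (Q I))"
      using dep_W depQ by (metis Un_commute insert_is_Un)
    then have "dep {..<Suc d} {..<Suc d} (W d I (Q I))"
      by (rule dep_mono) (use that in auto)
    moreover have "dep {..<Suc d} {..<Suc d} (Q I)"
      by (rule dep_mono[OF depQ]) auto
    ultimately show "dep {..<Suc d} {..<Suc d} (P I)"
      unfolding P_def by (intro dep_imp)
    show "forced (Suc d) (P I)"
      using moves[of "card I", unfolded moves_def, rule_format, OF QQQ, of I 0 d "Suc d" I] depQ[of I] that
      by (simp add: P_def[abs_def] atMost_atLeast0)
  qed
  then have "\<exists>D N. admissible D \<and> (\<forall>a c. Good D N a c \<longrightarrow> (\<exists>g. inc (Suc d) N g \<and>
      (\<forall>(k, P)\<in>(\<lambda>I. (Suc d, P I)) ` Pow {..d}. hold k (P b) (Suc d) (a \<circ> g) (c \<circ> g))))"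
    by (intro forced_finite) auto
  then obtain D N where D: "admissible D" and N: "\<And>a c. Good D N a c \<Longrightarrow> (\<exists>g. inc (Suc d) N g \<and>
      (\<forall>(k, P)\<in>(\<lambda>I. (Suc d, P I)) ` Pow {..d}. hold k (P b) (Suc d) (a \<circ> g) (c \<circ> g)))"
    by blast
  obtain a0 c0 where good0: "Good D N a0 c0" using Good_exists[OF D] by blast
  then obtain g where g: "inc (Suc d) N g"
    and hold: "\<forall>(k, P)\<in>(\<lambda>I. (Suc d, P I)) ` Pow {..d}. hold k (P b) (Suc d) (a0 \<circ> g) (c0 \<circ> g)"
    using N by blast
  define a c where "a = a0 \<circ> g" and "c = c0 \<circ> g"
  have good: "Good D (Suc d) a c" using Good_sub[OF good0 g] by (simp add: a_def c_def)
  have P: "hold (Suc d) (P I b) (Suc d) a c" if "I \<subseteq> {..d}" for I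
    using hold that by (simp add: a_def c_def)
  have "\<exists>u. \<forall>i<Suc d. Z u (a i) \<longleftrightarrow> i \<in> I" if I: "I \<subseteq> {..<Suc d}" for I
  proof -
    have "I \<subseteq> {..d}" using I by auto
    then have "P I b a c" using hold_at[OF P] by blast
    moreover have "Q I b a c" using good by (auto simp: Good_def Q_def)
    ultimately obtain u where u: "\<forall>t\<in>I. Z u (a t)" "Q I b a (c(d := u))"
      unfolding P_def W_def by blast
    show ?thesis
      by (rule exI[of _ u]) (use u in \<open>auto simp: Q_def\<close>)
  qed
  then have "Suc d \<le> d" by (rule d)
  then show False by simp
qed


end

text \<open>
  A failing instance of \<open>moves\<close> with the least possible \<open>card T'\<close>. It is copied to \<open>L\<close> disjoint blocks
  of one long sequence, where \<open>W m T' Q0\<close> is false at \<open>b\<close> in every block. For \<open>I \<subseteq> {..<L}\<close>, treat the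
  blocks in \<open>I\<close> one after the other: moving \<open>c m\<close> in such a block with \<open>card T' - 1\<close> hits, and then \<open>b\<close>
  itself into \<open>X\<close> at the remaining \<open>a t0\<close>, makes \<open>W m T' Q0\<close> true in that block and leaves the other
  blocks alone. Hence \<open>W m T' Q0\<close> shatters \<open>L\<close> points.
\<close>

locale failing_move = obstruction QQ NN X \<psi> AA CC b
  for QQ :: "('t \<Rightarrow> (nat \<Rightarrow> 't) \<Rightarrow> (nat \<Rightarrow> 't) \<Rightarrow> bool) set"
    and NN X \<psi> AA CC b +
  fixes k q m :: nat and T' :: "nat set" and Q0 and t0 :: nat and L :: nat
  assumes Q0: "Q0 \<in> QQ" and T': "T' \<subseteq> {q..m}" and m: "q \<le> m" "m < k" and t0: "t0 \<in> T'"
    and dep_Q0: "dep ({..<k} - T') ({..<q} \<union> {m}) Q0"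
    and fails: "\<not> forced k (\<lambda>y a c. Q0 y a c \<longrightarrow> W m T' Q0 y a c)"
    and moves: "moves (card T' - 1)"
begin

lemma finite_T' [simp]: "finite T'"
  using T' finite_subset by blast

text \<open>The indices below \<open>q\<close> are shared by all blocks, since the entries
  \<open>c j\<close> with \<open>j < q\<close> are context that no move changes. The rest of block
  \<open>i\<close> is an interval of length \<open>k - q\<close> following the earlier
  blocks.\<close>

definition sh :: "nat \<Rightarrow> nat \<Rightarrow> nat" where
  "sh i j = (if j < q then j else j + i * (k - q))"

lemma strict_mono_sh: "strict_mono (sh i)"
  by (auto simp: sh_def strict_mono_def)

lemma sh_less: "i < i' \<Longrightarrow> j < k \<Longrightarrow> q \<le> j' \<Longrightarrow> sh i j < sh i' j'"
proof -
  assume *: "i < i'" "j < k" "q \<le> j'"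
  have "Suc i * (k - q) \<le> i' * (k - q)" using * by (intro mult_right_mono) auto
  then have "i * (k - q) + (k - q) \<le> i' * (k - q)" by simp
  then show ?thesis using * m by (auto simp: sh_def)
qed

lemma sh_ge: "q \<le> j \<Longrightarrow> q \<le> sh i j"
  by (auto simp: sh_def)

lemma sh_low: "j < q \<Longrightarrow> sh i j = j"
  by (auto simp: sh_def)

abbreviation "K \<equiv> sh L q"

lemma sh_less_K: "i < L \<Longrightarrow> j < k \<Longrightarrow> sh i j < K"
  using sh_less by blast

abbreviation "Xb \<equiv> W m T' Q0"

lemma Xb_Q: "Xb \<in> QQ"
  by (simp add: Q_W Q0)

lemma dep_Xb: "dep {..<k} {..<q} Xb"
proof -
  have "dep ({..<k} - T' \<union> T') {..<q} Xb"
    using dep_W dep_Q0 by (metis Un_commute insert_is_Un)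
  then show ?thesis by (rule dep_mono) (use T' m in auto)
qed

text \<open>
  \<open>FF I\<close> is the goal of the moves, and \<open>Th I i\<close> says that it can be reached by moves in the blocks
  \<open>s \<in> I\<close> with \<open>s \<ge> i\<close>.
\<close>

definition FF where
  "FF I y a c \<longleftrightarrow> (\<forall>s\<in>I. \<psi> y (c (sh s m)) \<and> Q0 y (a \<circ> sh s) (c \<circ> sh s)) \<and>
    (\<forall>s\<in>{..<L} - I. \<not> Xb y (a \<circ> sh s) (c \<circ> sh s))"

abbreviation "T \<equiv> T' - {t0}"

text \<open>The new point \<open>y'\<close> violates the instance at \<open>t0\<close> and satisfies
  \<open>\<psi>\<close> with the new \<open>u\<close>, so \<open>u\<close> meets this instance as
  well. Thus \<open>card T' - 1\<close> prescribed hits suffice for all of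
  \<open>T'\<close>.\<close>

definition step where
  "step i R y a c \<longleftrightarrow> (\<exists>y'. X y' (a (sh i t0)) \<and> W (sh i m) (sh i ` T) R y' a c)"

definition Th where
  "Th I i = foldr (\<lambda>i R. if i \<in> I then step i R else R) [i..<L] (FF I)"

lemma Th_L: "Th I L = FF I"
  by (simp add: Th_def)

lemma Th_less: "i < L \<Longrightarrow> Th I i = (if i \<in> I then step i (Th I (Suc i)) else Th I (Suc i))"
  by (simp add: Th_def upt_conv_Cons)

lemma Q_step: "R \<in> QQ \<Longrightarrow> step i R \<in> QQ"
proof -
  assume "R \<in> QQ"
  then have "W (sh i m) (sh i ` T) R \<in> QQ"
    by (intro Q_W) auto
  from Q_ex[OF Q_conj[OF Q_X[of "sh i t0"] this]] show ?thesis
    by (simp add: step_def[abs_def])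
qed

lemma Q_Th:
  assumes I: "I \<subseteq> {..<L}" "i \<le> L"
  shows "Th I i \<in> QQ"
  using assms(2)
proof (induction i rule: inc_induct)
  case base
  have "(\<lambda>y a c. (\<forall>s\<in>I. \<psi> y (c (sh s m)) \<and> Q0 y (a \<circ> sh s) (c \<circ> sh s)) \<and>
    (\<forall>s\<in>{..<L} - I. \<not> Xb y (a \<circ> sh s) (c \<circ> sh s))) \<in> QQ"
    using I(1) finite_subset by (intro Q_conj Q_Ball Q_psi Q_neg Q_reindex Q0 Xb_Q) auto
  then show ?case by (simp add: Th_L FF_def[abs_def])
next
  case (step n)
  then show ?case by (simp add: Th_less Q_step)
qed

text \<open>In a block of \<open>I\<close> the condition on \<open>a\<close> is \<open>Q0\<close>,
  which ignores \<open>T'\<close>; in the other blocks it is the negation of \<open>Xb\<close>,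
  which ignores all \<open>c j\<close> with \<open>j \<ge> q\<close>. Disjointness of the blocks
  keeps the two from interfering.\<close>

lemma dep_FF:
  assumes "I \<subseteq> {..<L}"
  shows "dep ({..<K} - (\<Union>s\<in>I. sh s ` T')) ({..<q} \<union> (\<lambda>s. sh s m) ` I) (FF I)"
proof (rule depI)
  fix y and a c a' c' :: "nat \<Rightarrow> 't"
  assume a: "\<And>j. j \<in> {..<K} - (\<Union>s\<in>I. sh s ` T') \<Longrightarrow> a j = a' j"
    and c: "\<And>j. j \<in> {..<q} \<union> (\<lambda>s. sh s m) ` I \<Longrightarrow> c j = c' j"
    and FF: "FF I y a c"
  have low: "t < k \<Longrightarrow> i \<noteq> i' \<Longrightarrow> sh i t \<notin> sh i' ` T'" for t i i'
  proof (rule notI)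
    assume *: "t < k" "i \<noteq> i'" "sh i t \<in> sh i' ` T'"
    then obtain t' where t': "t' \<in> T'" "sh i t = sh i' t'" by blast
    then have "q \<le> t'" "t' < k" using T' m by auto
    then show False
      using * t' sh_less[of i i' t t'] sh_less[of i' i t' t] sh_ge[of t' i'] sh_low[of t i]
      by (cases "t < q"; cases "i < i'") auto
  qed
  have own: "sh i t \<notin> sh i ` T'" if "t \<notin> T'" for t i
    using that strict_mono_eq[OF strict_mono_sh] by auto
  have aI: "a (sh s j) = a' (sh s j)" if "s \<in> I" "j \<in> {..<k} - T'" for s j
  proof (rule a)
    have "sh s j < K" using that assms by (intro sh_less_K) auto
    moreover have "sh s j \<notin> sh i ` T'" for i
      using low[of j s i] own[of j s] that by (cases "s = i") auto
    ultimately show "sh s j \<in> {..<K} - (\<Union>s\<in>I. sh s ` T')" by auto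
  qed
  have aN: "a (sh s j) = a' (sh s j)" if "s < L" "s \<notin> I" "j < k" for s j
  proof (rule a)
    have "sh s j < K" using that assms by (intro sh_less_K) auto
    moreover have "sh s j \<notin> sh i ` T'" if "i \<in> I" for i
      using low[of j s i] that \<open>s \<notin> I\<close> \<open>j < k\<close> by (cases "s = i") auto
    ultimately show "sh s j \<in> {..<K} - (\<Union>s\<in>I. sh s ` T')" by auto
  qed
  have "Q0 y (a \<circ> sh s) (c \<circ> sh s) = Q0 y (a' \<circ> sh s) (c' \<circ> sh s)" if "s \<in> I" for s
    by (rule depD[OF dep_Q0]) (use aI that c sh_low in auto)
  moreover have "Xb y (a \<circ> sh s) (c \<circ> sh s) = Xb y (a' \<circ> sh s) (c' \<circ> sh s)" if "s < L" "s \<notin> I" for s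
    by (rule depD[OF dep_Xb]) (use aN that c sh_low in auto)
  ultimately show "FF I y a' c'" using FF c unfolding FF_def by auto
qed

text \<open>Block \<open>i\<close> loses its moved entry of \<open>c\<close> and regains its
  instances at \<open>T\<close>, but not the one at \<open>t0\<close>. This is what goodness needs
  at \<open>sh i t0\<close>.\<close>

lemma dep_W_Th:
  assumes "I \<subseteq> {..<L}" "i < L"
    and R: "dep ({..<K} - (\<Union>s\<in>I \<inter> {..i}. sh s ` T')) ({..<q} \<union> (\<lambda>s. sh s m) ` (I \<inter> {..i})) R"
    and "i \<in> I"
  shows "dep ({..<K} - {sh i t0} - (\<Union>s\<in>I \<inter> {..<i}. sh s ` T')) ({..<q} \<union> (\<lambda>s. sh s m) ` (I \<inter> {..<i}))
    (W (sh i m) (sh i ` T) R)"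
proof -
  have split: "I \<inter> {..i} = insert i (I \<inter> {..<i})" using assms(4) by auto
  have "dep ({..<K} - (\<Union>s\<in>I \<inter> {..i}. sh s ` T'))
      (insert (sh i m) ({..<q} \<union> (\<lambda>s. sh s m) ` (I \<inter> {..<i}))) R"
    using R unfolding split by (rule dep_mono) auto
  note dep_W[OF this, of "sh i ` T"]
  then show ?thesis
  proof (rule dep_mono)
    have 1: "sh i t < K" if "t \<in> T'" for t using that assms(2) T' m by (intro sh_less_K) auto
    have 2: "sh i t \<noteq> sh i t0" if "t \<in> T" for t
      using that strict_mono_eq[OF strict_mono_sh] by auto
    have 3: "sh i t \<noteq> sh s t'" if "t \<in> T" "s < i" "t' \<in> T'" for t s t'
      using sh_less[of s i t' t] that T' m by fastforce
    have "sh i t \<in> {..<K} - {sh i t0} - (\<Union>s\<in>I \<inter> {..<i}. sh s ` T')" if "t \<in> T" for t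
      using 1[of t] 2[OF that] 3[OF that] that by auto
    moreover have "x \<in> {..<K} - {sh i t0} - (\<Union>s\<in>I \<inter> {..<i}. sh s ` T')"
      if "x \<in> {..<K} - (\<Union>s\<in>I \<inter> {..i}. sh s ` T')" for x
      using that t0 unfolding split by auto
    ultimately show "{..<K} - (\<Union>s\<in>I \<inter> {..i}. sh s ` T') \<union> sh i ` T
      \<subseteq> {..<K} - {sh i t0} - (\<Union>s\<in>I \<inter> {..<i}. sh s ` T')"
      by (intro Un_least image_subsetI subsetI)
  qed auto
qed

text \<open>In the blocks of \<open>I\<close> before \<open>i\<close>, where no move has been
  quantified yet, the goal still ignores the instances at \<open>T'\<close>. Taken at
  \<open>Suc i\<close>, this is the independence that \<open>moves\<close> requires in block
  \<open>i\<close>.\<close>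

lemma dep_Th:
  assumes I: "I \<subseteq> {..<L}" and "i \<le> L"
  shows "dep ({..<K} - (\<Union>s\<in>I \<inter> {..<i}. sh s ` T')) ({..<q} \<union> (\<lambda>s. sh s m) ` (I \<inter> {..<i})) (Th I i)"
  using assms(2)
proof (induction i rule: inc_induct)
  case base
  have "I \<inter> {..<L} = I" using I by auto
  then show ?case using dep_FF[OF I] by (simp add: Th_L)
next
  case (step i)
  show ?case
  proof (cases "i \<in> I")
    case False
    then have "I \<inter> {..<Suc i} = I \<inter> {..<i}" by (auto simp: less_Suc_eq)
    then show ?thesis using step False by (simp add: Th_less)
  next
    case True
    let ?R = "Th I (Suc i)"
    have W: "dep ({..<K} - {sh i t0} - (\<Union>s\<in>I \<inter> {..<i}. sh s ` T')) ({..<q} \<union> (\<lambda>s. sh s m) ` (I \<inter> {..<i}))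
      (W (sh i m) (sh i ` T) ?R)"
      by (rule dep_W_Th) (use step I True in \<open>auto simp: lessThan_Suc_atMost\<close>)
    have t0': "sh i t0 \<in> {..<K} - (\<Union>s\<in>I \<inter> {..<i}. sh s ` T')"
    proof -
      have "q \<le> t0" "t0 < k" using t0 T' m by auto
      moreover have "sh s t \<noteq> sh i t0" if "s < i" "t \<in> T'" for s t
        using sh_less[of s i t t0] that \<open>q \<le> t0\<close> T' m by auto
      ultimately show ?thesis using sh_less_K[OF step.hyps(2)] by fastforce
    qed
    show ?thesis
      unfolding Th_less[OF step.hyps(2)] if_P[OF True]
    proof (rule depI)
      fix y a c a' c'
      assume a: "\<And>j. j \<in> {..<K} - (\<Union>s\<in>I \<inter> {..<i}. sh s ` T') \<Longrightarrow> a j = a' j"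
        and c: "\<And>j. j \<in> {..<q} \<union> (\<lambda>s. sh s m) ` (I \<inter> {..<i}) \<Longrightarrow> c j = c' j"
        and st: "step i ?R y a c"
      have "W (sh i m) (sh i ` T) ?R y' a c = W (sh i m) (sh i ` T) ?R y' a' c'" for y'
        by (rule depD[OF W]) (use a c in auto)
      then show "step i ?R y a' c'" using st a[OF t0'] unfolding step_def by simp
    qed
  qed
qed

text \<open>The successive \<open>u\<close> are collected in \<open>c'\<close>, and the last point
  is \<open>w\<close>. Hits survive later changes of the point because \<open>Z u x\<close> does not
  mention it.\<close>

lemma Th_extract:
  assumes I: "I \<subseteq> {..<L}" and "i \<le> L"
  shows "Th I i y a c \<Longrightarrow> \<exists>w c'. FF I w a c' \<and> (\<forall>j. j \<notin> (\<lambda>s. sh s m) ` (I \<inter> {i..}) \<longrightarrow> c' j = c j) \<and>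
    (\<forall>s\<in>I \<inter> {i..}. \<forall>t\<in>T'. Z (c' (sh s m)) (a (sh s t)))"
  using assms(2)
proof (induction i arbitrary: y c rule: inc_induct)
  case base
  have "I \<inter> {L..} = {}" using I by auto
  then show ?case using base by (auto simp: Th_L)
next
  case (step i)
  show ?case
  proof (cases "i \<in> I")
    case False
    then have "I \<inter> {i..} = I \<inter> {Suc i..}" by (auto simp: Suc_le_eq le_less)
    then show ?thesis using step False by (simp add: Th_less)
  next
    case True
    have split: "I \<inter> {i..} = insert i (I \<inter> {Suc i..})" using True by (auto simp: Suc_le_eq le_less)
    obtain y' u where y': "X y' (a (sh i t0))" "\<psi> y' u" "\<forall>t\<in>sh i ` T. Z u (a t)"
      "Th I (Suc i) y' a (c(sh i m := u))"
      using step.prems step.hyps True by (auto simp: Th_less step_def W_def)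
    obtain w c' where w: "FF I w a c'"
      "\<forall>j. j \<notin> (\<lambda>s. sh s m) ` (I \<inter> {Suc i..}) \<longrightarrow> c' j = (c(sh i m := u)) j"
      "\<forall>s\<in>I \<inter> {Suc i..}. \<forall>t\<in>T'. Z (c' (sh s m)) (a (sh s t))"
      using step.IH[OF y'(4)] by blast
    have "sh i m \<noteq> sh s m" if "i < s" for s
      using sh_less[OF that m(2) m(1)] by simp
    then have "sh i m \<notin> (\<lambda>s. sh s m) ` (I \<inter> {Suc i..})" unfolding image_iff by (metis Int_iff atLeast_iff Suc_le_eq)
    then have "c' (sh i m) = u" using w(2) by simp
    moreover have "Z u (a (sh i t))" if "t \<in> T'" for t
      using that y' by (cases "t = t0") (auto simp: Z_def)
    ultimately show ?thesis
      unfolding split using w by (intro exI[of _ w] exI[of _ c']) auto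
  qed
qed

text \<open>The moved sequence \<open>c'\<close> is only a detour: \<open>Xb\<close> quantifies over
  the moved entry, so it can be evaluated with the original \<open>c\<close>. Hence the points being
  shattered do not depend on \<open>I\<close>.\<close>

lemma Th_Xb:
  assumes I: "I \<subseteq> {..<L}" and "Th I 0 y a c"
  shows "\<exists>w. \<forall>s<L. Xb w (a \<circ> sh s) (c \<circ> sh s) \<longleftrightarrow> s \<in> I"
proof -
  obtain w c' where w: "FF I w a c'"
      "\<And>j. j \<notin> (\<lambda>s. sh s m) ` I \<Longrightarrow> c' j = c j"
      "\<And>s t. s \<in> I \<Longrightarrow> t \<in> T' \<Longrightarrow> Z (c' (sh s m)) (a (sh s t))"
    using Th_extract[OF I _ assms(2)] by auto
  have low: "c' j = c j" if "j < q" for j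
  proof -
    have "sh s m \<noteq> j" for s using sh_ge[OF m(1), of s] that by simp
    then show ?thesis using w(2)[of j] by blast
  qed
  have "Xb w (a \<circ> sh s) (c \<circ> sh s) \<longleftrightarrow> s \<in> I" if "s < L" for s
  proof (cases "s \<in> I")
    case True
    have "Q0 w (a \<circ> sh s) ((c \<circ> sh s)(m := c' (sh s m))) = Q0 w (a \<circ> sh s) (c' \<circ> sh s)"
      by (rule depD[OF dep_Q0]) (use low sh_low m in auto)
    then have "Xb w (a \<circ> sh s) (c \<circ> sh s)"
      unfolding W_def using w True by (intro exI[of _ "c' (sh s m)"]) (auto simp: FF_def)
    then show ?thesis using True by simp
  next
    case False
    have "Xb w (a \<circ> sh s) (c \<circ> sh s) = Xb w (a \<circ> sh s) (c' \<circ> sh s)"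
      by (rule depD[OF dep_Xb]) (use low sh_low in auto)
    then show ?thesis using w(1) False that by (auto simp: FF_def)
  qed
  then show ?thesis by blast
qed

lemma shattered:
  "\<exists>a c. \<forall>I\<subseteq>{..<L}. \<exists>w. \<forall>s<L. Xb w (a \<circ> sh s) (c \<circ> sh s) \<longleftrightarrow> s \<in> I"
proof -
  \<comment> \<open>The first half of \<open>step i\<close>, before \<open>b\<close> is moved to
    violate the instance at \<open>t0\<close>.\<close>
  define E where "E I i = W (sh i m) (sh i ` T) (Th I (Suc i))" for I i
  define P where "P I i y a c \<longleftrightarrow> (Th I (Suc i) y a c \<longrightarrow> E I i y a c)" for I i y a c
  define J where "J = (SIGMA I:Pow {..<L}. I)"
  have finJ: "finite J"
    unfolding J_def by (intro finite_SigmaI) (auto intro: finite_subset)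
  have dep_E: "dep ({..<K} - {sh i t0} - (\<Union>s\<in>I \<inter> {..<i}. sh s ` T')) ({..<q} \<union> (\<lambda>s. sh s m) ` (I \<inter> {..<i})) (E I i)"
    if "(I, i) \<in> J" for I i
    unfolding E_def
    by (rule dep_W_Th) (use that dep_Th[of I "Suc i"] in \<open>auto simp: J_def lessThan_Suc_atMost\<close>)
  have dep_E': "dep {..<K} {..<K} (E I i)" if "(I, i) \<in> J" for I i
    using dep_E[OF that]
    by (rule dep_mono) (use that sh_less_K[of _ m] m sh_ge[of q L] in \<open>auto simp: J_def\<close>)
  have "dep {..<K} {..<K} (P I i) \<and> forced K (P I i)" if Ii: "(I, i) \<in> J" for I i
  proof
    have I: "I \<subseteq> {..<L}" "i \<in> I" "i < L" using Ii by (auto simp: J_def)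
    have dT: "dep ({..<K} - (\<Union>s\<in>I \<inter> {..i}. sh s ` T')) ({..<q} \<union> (\<lambda>s. sh s m) ` (I \<inter> {..i})) (Th I (Suc i))"
      using dep_Th[OF I(1), of "Suc i"] I by (simp add: lessThan_Suc_atMost)
    have "dep {..<K} {..<K} (Th I (Suc i))"
      using dT by (rule dep_mono) (use I sh_less_K[of _ m] m sh_ge[of q L] in auto)
    then show "dep {..<K} {..<K} (P I i)"
      unfolding P_def using dep_E'[OF Ii] by (rule dep_imp)
    have "dep ({..<K} - sh i ` T) ({..<sh i q} \<union> {sh i m}) (Th I (Suc i))"
      using dT
    proof (rule dep_mono)
      show "{..<q} \<union> (\<lambda>s. sh s m) ` (I \<inter> {..i}) \<subseteq> {..<sh i q} \<union> {sh i m}"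
        using sh_less[of _ i m q] m sh_ge[of q i] by (auto simp: le_less)
    qed (use I in auto)
    moreover have "sh i ` T \<subseteq> {sh i q..sh i m}"
      using T' strict_mono_less_eq[OF strict_mono_sh] by auto
    moreover have "card (sh i ` T) = card T' - 1"
      using t0 card_image[OF inj_on_subset[OF strict_mono_imp_inj_on[OF strict_mono_sh[of i]] subset_UNIV]]
      by (simp add: card_Diff_singleton)
    ultimately show "forced K (P I i)"
      using moves[unfolded moves_def, rule_format, of "Th I (Suc i)" "sh i ` T" "sh i q" "sh i m" K]
        Q_Th[OF I(1), of "Suc i"] I sh_less_K[of i m] m strict_mono_less_eq[OF strict_mono_sh]
      by (simp add: P_def[abs_def] E_def[abs_def])
  qed
  then have "\<exists>D N. admissible D \<and> (\<forall>a c. Good D N a c \<longrightarrow> (\<exists>g. inc K N g \<and>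
      (\<forall>(k, P)\<in>(\<lambda>(I, i). (K, P I i)) ` J. hold k (P b) K (a \<circ> g) (c \<circ> g))))"
    by (intro forced_finite finite_imageI finJ) auto
  then obtain D N where D: "admissible D" and N: "\<And>a c. Good D N a c \<Longrightarrow> (\<exists>g. inc K N g \<and>
      (\<forall>(k, P)\<in>(\<lambda>(I, i). (K, P I i)) ` J. hold k (P b) K (a \<circ> g) (c \<circ> g)))"
    by blast
  \<comment> \<open>Goodness for these conditions will supply the points violating the instances at
    \<open>t0\<close>.\<close>
  define D2 where "D2 = (\<lambda>(I, i). (K, E I i)) ` J"
  have "E I i \<in> QQ" if "(I, i) \<in> J" for I i
    unfolding E_def using that
    by (intro Q_W Q_Th finite_imageI) (auto simp: J_def)
  then have "admissible D2"
    unfolding admissible_def D2_def using finJ dep_E' by auto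
  then have "admissible (D \<union> D2)" using D by (auto simp: admissible_def)
  \<comment> \<open>Failure of forcing applies to every admissible set and every length, in
    particular to those just chosen.\<close>
  then obtain a0 c0 where good0: "Good (D \<union> D2) N a0 c0"
    and hold0: "hold k (\<lambda>a c. \<not> (Q0 b a c \<longrightarrow> Xb b a c)) N a0 c0"
    using fails unfolding forced_def by blast
  obtain g where g: "inc K N g"
    and holdP: "\<forall>(k, P)\<in>(\<lambda>(I, i). (K, P I i)) ` J. hold k (P b) K (a0 \<circ> g) (c0 \<circ> g)"
    using N[OF Good_antimono[OF good0]] by blast
  define a c where "a = a0 \<circ> g" and "c = c0 \<circ> g"
  have good: "Good D2 K a c"
    using Good_sub[OF Good_antimono[OF good0] g] by (simp add: a_def c_def)
  have P: "P I i b a c" if "(I, i) \<in> J" for I i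
    using holdP that by (intro hold_at[of K "P I i b" K]) (auto simp: a_def c_def)
  have Q0b: "Q0 b (a \<circ> sh s) (c \<circ> sh s) \<and> \<not> Xb b (a \<circ> sh s) (c \<circ> sh s)" if "s < L" for s
  proof -
    have "inc k K (sh s)" using that strict_mono_sh sh_less_K by (auto simp: inc_def)
    then show ?thesis
      using hold_sub[OF hold0 g] by (auto simp: hold_def a_def c_def)
  qed
  \<comment> \<open>Going down through the blocks, \<open>P\<close> performs the move at
    \<open>b\<close>, and goodness then replaces \<open>b\<close> by a violating \<open>y\<close>.
    Since \<open>step\<close> forgets its point argument, the result is again a statement at
    \<open>b\<close>.\<close>
  have "Th I i b a c" if I: "I \<subseteq> {..<L}" and "i \<le> L" for I i
    using that(2)
  proof (induction i rule: inc_induct)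
    case base
    have "\<psi> b (c (sh s m))" if "s < L" for s
      using good sh_less_K[OF that m(2)] by (auto simp: Good_def)
    then show ?case using Q0b I by (auto simp: Th_L FF_def)
  next
    case (step i)
    show ?case
    proof (cases "i \<in> I")
      case True
      then have Ii: "(I, i) \<in> J" using I by (auto simp: J_def)
      then have Eb: "E I i b a c" using P step.IH by (auto simp: P_def)
      have "dep (-{sh i t0}) {..<sh i t0} (E I i)"
        using dep_E[OF Ii]
      proof (rule dep_mono)
        show "{..<q} \<union> (\<lambda>s. sh s m) ` (I \<inter> {..<i}) \<subseteq> {..<sh i t0}"
          using sh_less[of _ i m t0] sh_ge[of t0 i] T' t0 m by fastforce
      qed auto
      moreover have "sh i t0 < K" using sh_less_K[OF step.hyps(2)] t0 T' m by force
      moreover have "(K, E I i) \<in> D2" using Ii by (auto simp: D2_def)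
      moreover have "\<forall>h t. inc K K h \<longrightarrow> t < K \<longrightarrow> dep (-{t}) {..<t} (E I i) \<longrightarrow>
          E I i b (a \<circ> h) (c \<circ> h) \<longrightarrow> (\<exists>y. X y (a (h t)) \<and> E I i y (a \<circ> h) (c \<circ> h))"
        using good \<open>(K, E I i) \<in> D2\<close> unfolding Good_def by blast
      from this[rule_format, of id] have "\<exists>y. X y (a (sh i t0)) \<and> E I i y a c"
        if "sh i t0 < K" "dep (-{sh i t0}) {..<sh i t0} (E I i)"
        using that Eb inc_id[of K K] by simp
      ultimately obtain y where "X y (a (sh i t0))" "E I i y a c" by blast
      then show ?thesis using True step.hyps by (auto simp: Th_less step_def E_def)
    next
      case False
      then show ?thesis using step by (simp add: Th_less)
    qed
  qed
  then show ?thesis using Th_Xb by blast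
qed

end

context obstruction
begin

theorem inconsistent: False
proof -
  define p where "p = (LEAST p. \<not> moves p)"
  have p: "\<not> moves p" "\<And>p'. p' < p \<Longrightarrow> moves p'"
    using LeastI_ex[OF not_all_moves] not_less_Least[of _ "\<lambda>p. \<not> moves p"]
    unfolding p_def by blast+
  then have "p \<noteq> 0" using moves_0 by metis
  obtain k q T m Q where Q: "Q \<in> QQ" "T \<subseteq> {q..m}" "q \<le> m" "m < k" "card T = p"
    "dep ({..<k} - T) ({..<q} \<union> {m}) Q" "\<not> forced k (\<lambda>y a c. Q y a c \<longrightarrow> W m T Q y a c)"
    using p(1) unfolding moves_def by blast
  then obtain t0 where t0: "t0 \<in> T" using \<open>p \<noteq> 0\<close> by fastforce
  have "W m T Q \<in> QQ" using Q finite_subset by (intro Q_W) auto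
  from nip[OF this]
  obtain d where d: "\<And>(n::nat) a c. (\<forall>I\<subseteq>{..<n}. \<exists>w. \<forall>i<n. W m T Q w (a i) (c i) \<longleftrightarrow> i \<in> I) \<Longrightarrow> n \<le> d"
    by blast
  \<comment> \<open>One block more than the bound \<open>d\<close> permits, for the least number of
    hits that is not always forced.\<close>
  interpret failing_move QQ NN X \<psi> AA CC b k q m T Q t0 "Suc d"
    by unfold_locales (use Q t0 p(2)[of "p - 1"] \<open>p \<noteq> 0\<close> in auto)
  obtain a c where "\<forall>I\<subseteq>{..<Suc d}. \<exists>w. \<forall>s<Suc d. W m T Q w (a \<circ> sh s) (c \<circ> sh s) \<longleftrightarrow> s \<in> I"
    using shattered by blast
  then have "Suc d \<le> d" by (rule d)
  then show False by simp
qed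

end

section \<open>Adding one element\<close>

lemma case_sum_upd_Inl: "(case_sum v p)(Inl x := u) = case_sum (v(x := u)) p"
  by (auto simp: fun_eq_iff split: sum.splits)

text \<open>
  A point is a \<open>'k\<close>-tuple. The variables \<open>Inl k\<close>, \<open>Inr (Inl (j, k))\<close> and \<open>Inr (Inr (j, k))\<close> stand for
  the coordinates of the point \<open>y\<close> and of the \<open>j\<close>-th entries of the sequences \<open>a\<close> and \<open>c\<close>.
\<close>

definition dpred ::
    "('f, 'r) fo_language \<Rightarrow> ('f, 'r, 'a) fo_structure \<Rightarrow>
      (('k \<Rightarrow> 'a) \<Rightarrow> (nat \<Rightarrow> 'k \<Rightarrow> 'a) \<Rightarrow> (nat \<Rightarrow> 'k \<Rightarrow> 'a) \<Rightarrow> bool) \<Rightarrow> bool" where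
  "dpred L M Q \<longleftrightarrow> definable L M UNIV
    (\<lambda>v. Q (v \<circ> Inl) (\<lambda>j k. v (Inr (Inl (j, k)))) (\<lambda>j k. v (Inr (Inr (j, k)))))"

lemma dpred_not: "dpred L M Q \<Longrightarrow> dpred L M (\<lambda>y a c. \<not> Q y a c)"
  unfolding dpred_def by (rule definable_not)

lemma dpred_conj: "dpred L M Q \<Longrightarrow> dpred L M Q' \<Longrightarrow> dpred L M (\<lambda>y a c. Q y a c \<and> Q' y a c)"
  unfolding dpred_def by (rule definable_conj)

lemma dpred_ex:
  assumes "dpred L M Q"
  shows "dpred L M (\<lambda>y a c. \<exists>y'. Q y' a c)"
proof -
  have eq: "(\<exists>v'. (\<forall>x. x \<notin> range Inl \<longrightarrow> v' x = v x) \<and>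
      Q (v' \<circ> Inl) (\<lambda>j k. v' (Inr (Inl (j, k)))) (\<lambda>j k. v' (Inr (Inr (j, k))))) \<longleftrightarrow>
    (\<exists>y'. Q y' (\<lambda>j k. v (Inr (Inl (j, k)))) (\<lambda>j k. v (Inr (Inr (j, k)))))" for v
  proof
    assume "\<exists>v'. (\<forall>x. x \<notin> range Inl \<longrightarrow> v' x = v x) \<and>
      Q (v' \<circ> Inl) (\<lambda>j k. v' (Inr (Inl (j, k)))) (\<lambda>j k. v' (Inr (Inr (j, k))))"
    then obtain v' where v': "\<And>x. x \<notin> range Inl \<Longrightarrow> v' x = v x"
      "Q (v' \<circ> Inl) (\<lambda>j k. v' (Inr (Inl (j, k)))) (\<lambda>j k. v' (Inr (Inr (j, k))))" by blast
    have "v' (Inr x) = v (Inr x)" for x by (rule v'(1)) auto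
    then show "\<exists>y'. Q y' (\<lambda>j k. v (Inr (Inl (j, k)))) (\<lambda>j k. v (Inr (Inr (j, k))))"
      using v'(2) by auto
  next
    assume "\<exists>y'. Q y' (\<lambda>j k. v (Inr (Inl (j, k)))) (\<lambda>j k. v (Inr (Inr (j, k))))"
    then obtain y' where "Q y' (\<lambda>j k. v (Inr (Inl (j, k)))) (\<lambda>j k. v (Inr (Inr (j, k))))" by blast
    then show "\<exists>v'. (\<forall>x. x \<notin> range Inl \<longrightarrow> v' x = v x) \<and>
      Q (v' \<circ> Inl) (\<lambda>j k. v' (Inr (Inl (j, k)))) (\<lambda>j k. v' (Inr (Inr (j, k))))"
      by (intro exI[of _ "case_sum y' (v \<circ> Inr)"]) (auto simp: case_sum_o_inj split: sum.splits)
  qed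
  show ?thesis
    using definable_ex[OF assms[unfolded dpred_def], of "range Inl"] definable_mono
    unfolding eq dpred_def by blast
qed

lemma dpred_ex_upd:
  assumes "dpred L M Q"
  shows "dpred L M (\<lambda>y a c. \<exists>u. Q y a (c(m := u)))"
proof -
  let ?W = "range (\<lambda>k. Inr (Inr (m, k)))"
  have eq: "(\<exists>v'. (\<forall>x. x \<notin> ?W \<longrightarrow> v' x = v x) \<and>
      Q (v' \<circ> Inl) (\<lambda>j k. v' (Inr (Inl (j, k)))) (\<lambda>j k. v' (Inr (Inr (j, k))))) \<longleftrightarrow>
    (\<exists>u. Q (v \<circ> Inl) (\<lambda>j k. v (Inr (Inl (j, k)))) ((\<lambda>j k. v (Inr (Inr (j, k))))(m := u)))" for v
  proof
    assume "\<exists>v'. (\<forall>x. x \<notin> ?W \<longrightarrow> v' x = v x) \<and>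
      Q (v' \<circ> Inl) (\<lambda>j k. v' (Inr (Inl (j, k)))) (\<lambda>j k. v' (Inr (Inr (j, k))))"
    then obtain v' where v': "\<And>x. x \<notin> ?W \<Longrightarrow> v' x = v x"
      "Q (v' \<circ> Inl) (\<lambda>j k. v' (Inr (Inl (j, k)))) (\<lambda>j k. v' (Inr (Inr (j, k))))" by blast
    have 1: "v' \<circ> Inl = v \<circ> Inl" by (auto simp: fun_eq_iff intro!: v'(1))
    have 2: "v' (Inr (Inl x)) = v (Inr (Inl x))" for x by (rule v'(1)) auto
    have 3: "(\<lambda>j k. v' (Inr (Inr (j, k)))) = (\<lambda>j k. v (Inr (Inr (j, k))))(m := \<lambda>k. v' (Inr (Inr (m, k))))"
      by (auto simp: fun_eq_iff intro!: v'(1))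
    show "\<exists>u. Q (v \<circ> Inl) (\<lambda>j k. v (Inr (Inl (j, k)))) ((\<lambda>j k. v (Inr (Inr (j, k))))(m := u))"
      using v'(2) unfolding 1 2 3 by blast
  next
    assume "\<exists>u. Q (v \<circ> Inl) (\<lambda>j k. v (Inr (Inl (j, k)))) ((\<lambda>j k. v (Inr (Inr (j, k))))(m := u))"
    then obtain u where u: "Q (v \<circ> Inl) (\<lambda>j k. v (Inr (Inl (j, k)))) ((\<lambda>j k. v (Inr (Inr (j, k))))(m := u))"
      by blast
    define v' where "v' = case_sum (v \<circ> Inl) (case_sum (v \<circ> Inr \<circ> Inl)
      (\<lambda>(j, k). if j = m then u k else v (Inr (Inr (j, k)))))"
    have 1: "v' \<circ> Inl = v \<circ> Inl" "\<And>x. v' (Inr (Inl x)) = v (Inr (Inl x))"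
      by (auto simp: v'_def fun_eq_iff)
    have 2: "(\<lambda>j k. v' (Inr (Inr (j, k)))) = (\<lambda>j k. v (Inr (Inr (j, k))))(m := u)"
      by (auto simp: v'_def fun_eq_iff)
    have "v' x = v x" if "x \<notin> ?W" for x
      using that by (auto simp: v'_def split: sum.splits)
    then show "\<exists>v'. (\<forall>x. x \<notin> ?W \<longrightarrow> v' x = v x) \<and>
      Q (v' \<circ> Inl) (\<lambda>j k. v' (Inr (Inl (j, k)))) (\<lambda>j k. v' (Inr (Inr (j, k))))"
      using u by (intro exI[of _ v']) (simp add: 1 2)
  qed
  show ?thesis
    using definable_ex[OF assms[unfolded dpred_def], of ?W] definable_mono
    unfolding eq dpred_def by blast
qed

lemma dpred_reindex:
  assumes "dpred L M Q"
  shows "dpred L M (\<lambda>y a c. Q y (a \<circ> f) (c \<circ> g))"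
  unfolding dpred_def
  using definable_reindex[OF assms[unfolded dpred_def], of
      "map_sum id (map_sum (map_prod f id) (map_prod g id))" UNIV]
  by (simp add: comp_def)

lemma NIP_dpred:
  assumes "NIP L U" "dpred (add_constants L F) (name_elements U) Q"
  shows "\<exists>d. \<forall>(n::nat) a c. (\<forall>I\<subseteq>{..<n}. \<exists>w. \<forall>i<n. Q w (a i) (c i) \<longleftrightarrow> i \<in> I) \<longrightarrow> n \<le> d"
proof -
  obtain d where d: "\<forall>(n::nat) e. (\<forall>I\<subseteq>{..<n}. \<exists>w. \<forall>i<n. Q (case_sum w (e i) \<circ> Inl)
      (\<lambda>j k. case_sum w (e i) (Inr (Inl (j, k)))) (\<lambda>j k. case_sum w (e i) (Inr (Inr (j, k)))) \<longleftrightarrow> i \<in> I) \<longrightarrow> n \<le> d"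
    using NIP_definable[OF assms(1) assms(2)[unfolded dpred_def]] by (rule exE)
  show ?thesis
  proof (intro exI[of _ d] allI impI)
    fix n :: nat and a c
    assume "\<forall>I\<subseteq>{..<n}. \<exists>w. \<forall>i<n. Q w (a i) (c i) \<longleftrightarrow> i \<in> I"
    then show "n \<le> d"
      using d[THEN spec, THEN spec, THEN mp, of n
          "\<lambda>i. case_sum (\<lambda>(j, k). a i j k) (\<lambda>(j, k). c i j k)"]
      by (simp add: case_sum_o_inj)
  qed
qed

text \<open>The shattering side is now an entry of \<open>c\<close> instead of the point; the
  reindexing puts it in the place of the point.\<close>

lemma NIP_dpred_pair:
  assumes "NIP L U" "dpred (add_constants L F) (name_elements U) (\<lambda>y a c. R (c 0) (a 0))"
  shows "\<exists>d. \<forall>(n::nat) a. (\<forall>I\<subseteq>{..<n}. \<exists>w. \<forall>i<n. R w (a i) \<longleftrightarrow> i \<in> I) \<longrightarrow> n \<le> d"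
proof -
  have "definable (add_constants L F) (name_elements U) UNIV (\<lambda>v. R (v \<circ> Inl) (v \<circ> Inr))"
    using definable_reindex[OF assms(2)[unfolded dpred_def], of
      "case_sum Inl (case_sum (\<lambda>(j, k). Inr k) (\<lambda>(j, k). Inl k))" UNIV]
    by (simp add: comp_def)
  from NIP_definable[OF assms(1) this] show ?thesis
    by (simp add: case_sum_o_inj)
qed

text \<open>Elements serve as their own variables under the assignment \<open>id\<close>;
  \<open>e \<notin> C\<close> keeps the variable of \<open>e\<close> apart from those of
  \<open>C\<close>.\<close>

locale one_point_extension =
  fixes L' :: "('f, 'r) fo_language" and U :: "('f, 'r, 'a) fo_structure" and F A C :: "'a set"
    and e a0 :: 'a and L :: "('f + 'a, 'r) fo_language" and M :: "('f + 'a, 'r, 'a) fo_structure"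
  assumes L_def: "L = add_constants L' F" and M_def: "M = name_elements U"
    and NIP: "NIP L' U"
    and comp_C: "compressible L M C A id"
    and comp_e: "compressible L M (UNIV :: unit set) (A \<union> C) (\<lambda>_. e)"
    and e: "e \<notin> C" and a0: "a0 \<in> A"
begin

text \<open>
  A parameter tuple \<open>a\<close> from \<open>A\<close> is extended by the elements of \<open>C\<close>, each in the place of its own
  variable, so that it lies in \<open>A \<union> C\<close> and the compressibility of \<open>e\<close> over \<open>A \<union> C\<close> applies to it.
\<close>

definition norm :: "(nat \<Rightarrow> 'a) \<Rightarrow> 'a + nat \<Rightarrow> 'a" where
  "norm a = case_sum (\<lambda>w. if w \<in> C then w else a0) a"

lemma norm_simps [simp]: "norm a (Inl w) = (if w \<in> C then w else a0)" "norm a (Inr n) = a n"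
  by (simp_all add: norm_def)

lemma range_norm: "range a \<subseteq> A \<Longrightarrow> range (norm a) \<subseteq> A \<union> C"
  using a0 by (auto simp: norm_def image_subset_iff split: sum.splits)

definition V :: "('a + 'k) set" where "V = Inl ` insert e C \<union> range Inr"

lemma norm_upd:
  assumes "definable L M V P"
  shows "P ((norm a)(Inl e := u)) \<longleftrightarrow> P (case_sum (id(e := u)) a)"
  by (rule definable_depends[OF assms]) (use e in \<open>auto simp: V_def split: if_splits\<close>)

definition compresses_positive :: "(('a + nat \<Rightarrow> 'a) \<Rightarrow> bool) \<Rightarrow> (('a + 'k \<Rightarrow> 'a) \<Rightarrow> bool) \<Rightarrow> bool" where
  "compresses_positive P \<Psi> \<longleftrightarrow> definable L M V \<Psi> \<and>
    (\<forall>G. finite G \<longrightarrow> (\<forall>a\<in>G. range a \<subseteq> A) \<longrightarrow> (\<exists>c. range c \<subseteq> A \<and> \<Psi> (case_sum id c) \<and>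
      (\<forall>v. \<Psi> (case_sum v c) \<longrightarrow> (\<forall>a\<in>G. P (case_sum id a) \<longrightarrow> P (case_sum v a)))))"

definition VN :: "(('a + nat) + nat \<times> ('a + nat) + 'a) set" where
  "VN = range Inl \<union> Inr ` (range Inl \<union> Inr ` (A \<union> C))"

definition NN :: "(('a + nat \<Rightarrow> 'a) \<Rightarrow> (nat \<Rightarrow> 'a + nat \<Rightarrow> 'a) \<Rightarrow> bool) set" where
  "NN = {N. \<exists>R. definable L M VN R \<and> (\<forall>y E. N y E \<longleftrightarrow> R (case_sum y (case_sum (\<lambda>(j, k). E j k) id)))}"

lemma NN_True: "(\<lambda>y E. True) \<in> NN"
  unfolding NN_def using definable_True by blast

lemma NN_conj: "N \<in> NN \<Longrightarrow> N' \<in> NN \<Longrightarrow> (\<lambda>y E. N y E \<and> N' y E) \<in> NN"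
  unfolding NN_def using definable_conj by fastforce

lemma NN_inst:
  assumes "dpred L M Q" "\<And>j. range (\<alpha> j) \<subseteq> A \<union> C" "\<And>j. range (c j) \<subseteq> A \<union> C"
  shows "(\<lambda>y E. Q y (mix p \<alpha> E) c) \<in> NN"
proof -
  define f :: "_ \<Rightarrow> ('a + nat) + nat \<times> ('a + nat) + 'a" where
    "f = case_sum Inl (case_sum (\<lambda>(j, k). Inr (if j < p then Inr (\<alpha> j k) else Inl (j, k)))
    (\<lambda>(j, k). Inr (Inr (c j k))))"
  have f: "f ` UNIV \<subseteq> VN" using assms(2,3) by (auto simp: f_def VN_def image_subset_iff split: sum.splits)
  show ?thesis
    unfolding NN_def mem_Collect_eq
  proof (intro exI conjI allI, rule definable_reindex[OF assms(1)[unfolded dpred_def] f])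
    fix y :: "'a + nat \<Rightarrow> 'a" and E :: "nat \<Rightarrow> 'a + nat \<Rightarrow> 'a"
    let ?v = "case_sum y (case_sum (\<lambda>(j, k). E j k) id)"
    have "?v \<circ> f \<circ> Inl = y" "(\<lambda>j k. (?v \<circ> f) (Inr (Inl (j, k)))) = mix p \<alpha> E"
      "(\<lambda>j k. (?v \<circ> f) (Inr (Inr (j, k)))) = c"
      by (auto simp: f_def mix_def fun_eq_iff)
    then show "Q y (mix p \<alpha> E) c \<longleftrightarrow> Q (?v \<circ> f \<circ> Inl)
        (\<lambda>j k. (?v \<circ> f) (Inr (Inl (j, k)))) (\<lambda>j k. (?v \<circ> f) (Inr (Inr (j, k))))"
      by simp
  qed
qed

text \<open>This is where compressibility of \<open>C\<close> enters. That \<open>N\<close> with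
  parameters \<open>a'\<close> implies the instance \<open>a\<close> for all values in the place of
  \<open>e\<close> is a condition \<open>\<chi>\<close> on \<open>C\<close> alone. Some
  \<open>\<xi>\<close> with parameters from \<open>A\<close> compresses the truth of
  \<open>\<chi>\<close>, and \<open>\<xi>\<close> conjoined with \<open>N\<close> itself compresses
  the instances of \<open>P\<close>.\<close>

lemma compresses_positive_if_no_witnesses:
  fixes P :: "('a + nat \<Rightarrow> 'a) \<Rightarrow> bool"
  assumes P: "definable L M V P" and N: "N \<in> NN"
    and no_witness: "\<And>G. finite G \<Longrightarrow> (\<And>a. a \<in> G \<Longrightarrow> range a \<subseteq> A \<and> P (case_sum id a)) \<Longrightarrow>
      \<exists>a'. (\<forall>j. range (a' j) \<subseteq> A) \<and> N (\<lambda>_. e) (\<lambda>j. norm (a' j)) \<and>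
        (\<forall>a\<in>G. \<forall>u. N (\<lambda>_. u) (\<lambda>j. norm (a' j)) \<longrightarrow> P (case_sum (id(e := u)) a))"
  shows "\<exists>\<Psi> :: ('a + nat + nat \<times> nat + 'a \<Rightarrow> 'a) \<Rightarrow> bool. compresses_positive P \<Psi>"
proof -
  obtain R where R: "definable L M VN R" and N_R: "\<And>y E. N y E \<longleftrightarrow> R (case_sum y (case_sum (\<lambda>(j, k). E j k) id))"
    using N unfolding NN_def by blast
  \<comment> \<open>Constants from \<open>C\<close> have to vary with \<open>C\<close>, so they
    become its variables; those outside \<open>C\<close> become parameters from \<open>A\<close>.
    \<open>N\<close> is used at constant points only, so all coordinates of the point go to
    \<open>e\<close>.\<close>
  define f :: "('a + nat) + nat \<times> ('a + nat) + 'a \<Rightarrow> 'a + nat \<times> nat + 'a" where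
    "f = case_sum (\<lambda>_. Inl e) (case_sum
      (\<lambda>(j, k). case k of Inl w \<Rightarrow> if w \<in> C then Inl w else Inr (Inr a0) | Inr n \<Rightarrow> Inr (Inl (j, n)))
      (\<lambda>x. if x \<in> C then Inl x else Inr (Inr x)))"
  define \<delta> where "\<delta> v = R (v \<circ> f)" for v
  have \<delta>: "definable L M V \<delta>"
    unfolding \<delta>_def by (rule definable_reindex[OF R]) (auto simp: f_def V_def split: sum.splits prod.splits)
  define params where "params a' = case_sum (\<lambda>(j, n). a' j n) (\<lambda>x. if x \<in> A then x else a0)"
    for a' :: "nat \<Rightarrow> nat \<Rightarrow> 'a"
  have \<delta>_N: "\<delta> (case_sum (id(e := u)) (params a')) \<longleftrightarrow> N (\<lambda>_. u) (\<lambda>j. norm (a' j))" for u a'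
    unfolding \<delta>_def N_R
    by (rule definable_depends[OF R])
      (use e a0 in \<open>auto simp: VN_def f_def params_def split: sum.splits prod.splits\<close>)
  define \<chi> where "\<chi> v \<longleftrightarrow> \<not> (\<exists>u. \<delta> (v(Inl e := u) \<circ> map_sum id Inl) \<and> \<not> P (v(Inl e := u) \<circ> map_sum id Inr))"
    for v :: "'a + (nat \<times> nat + 'a) + nat \<Rightarrow> 'a"
  have "definable L M (V - {Inl e}) \<chi>"
    unfolding \<chi>_def
    by (intro definable_not definable_ex1[of L M _ "\<lambda>v. \<delta> (v \<circ> map_sum id Inl) \<and> \<not> P (v \<circ> map_sum id Inr)"]
        definable_conj definable_reindex[OF \<delta>] definable_reindex[OF P]) (auto simp: V_def)
  then have "definable L M (Inl ` C \<union> range Inr) \<chi>"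
    by (rule definable_mono) (auto simp: V_def)
  from compressibleD[OF comp_C this]
  obtain \<xi> where \<xi>: "definable L M (Inl ` C \<union> range (Inr :: nat \<Rightarrow> _)) \<xi>"
    and comp: "\<forall>G. finite G \<longrightarrow> (\<forall>a\<in>G. range a \<subseteq> A) \<longrightarrow>
      (\<exists>c. range c \<subseteq> A \<and> \<xi> (case_sum id c) \<and>
        (\<forall>v. \<xi> (case_sum v c) \<longrightarrow> (\<forall>a\<in>G. \<chi> (case_sum v a) \<longleftrightarrow> \<chi> (case_sum id a))))"
    by (elim exE conjE)
  define \<Psi> where "\<Psi> v \<longleftrightarrow> \<xi> (v \<circ> map_sum id Inl) \<and> \<delta> (v \<circ> map_sum id Inr)"
    for v :: "'a + nat + nat \<times> nat + 'a \<Rightarrow> 'a"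
  have "compresses_positive P \<Psi>"
    unfolding compresses_positive_def
  proof (intro conjI allI impI)
    show "definable L M V \<Psi>"
      unfolding \<Psi>_def
      by (intro definable_conj definable_reindex[OF \<xi>] definable_reindex[OF \<delta>]) (auto simp: V_def)
    fix G :: "(nat \<Rightarrow> 'a) set" assume G: "finite G" "\<forall>a\<in>G. range a \<subseteq> A"
    obtain a' where a': "\<And>j. range (a' j) \<subseteq> A" "N (\<lambda>_. e) (\<lambda>j. norm (a' j))"
      "\<And>a u. a \<in> G \<Longrightarrow> P (case_sum id a) \<Longrightarrow> N (\<lambda>_. u) (\<lambda>j. norm (a' j)) \<Longrightarrow> P (case_sum (id(e := u)) a)"
    proof -
      have "finite {a \<in> G. P (case_sum id a)}" using G(1) by simp
      moreover have "range a \<subseteq> A \<and> P (case_sum id a)" if "a \<in> {a \<in> G. P (case_sum id a)}" for a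
        using that G(2) by blast
      ultimately have "\<exists>a'. (\<forall>j. range (a' j) \<subseteq> A) \<and> N (\<lambda>_. e) (\<lambda>j. norm (a' j)) \<and>
        (\<forall>a\<in>{a \<in> G. P (case_sum id a)}. \<forall>u. N (\<lambda>_. u) (\<lambda>j. norm (a' j)) \<longrightarrow> P (case_sum (id(e := u)) a))"
        by (rule no_witness)
      then show ?thesis using that by blast
    qed
    have params: "range (params a') \<subseteq> A"
      using a'(1) a0 by (auto simp: params_def image_subset_iff split: sum.splits)
    have "finite ((\<lambda>a. case_sum (params a') a) ` G)" "\<forall>a\<in>(\<lambda>a. case_sum (params a') a) ` G. range a \<subseteq> A"
      using G params by (auto simp: image_subset_iff split: sum.splits)
    from comp[THEN spec, THEN mp, THEN mp, OF this]
    obtain c where c: "range c \<subseteq> A" "\<xi> (case_sum id c)" and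
      "\<forall>v. \<xi> (case_sum v c) \<longrightarrow> (\<forall>a\<in>(\<lambda>a. case_sum (params a') a) ` G. \<chi> (case_sum v a) \<longleftrightarrow> \<chi> (case_sum id a))"
      by (elim exE conjE)
    then have \<chi>: "\<xi> (case_sum v c) \<Longrightarrow> a \<in> G \<Longrightarrow>
      \<chi> (case_sum v (case_sum (params a') a)) \<longleftrightarrow> \<chi> (case_sum id (case_sum (params a') a))" for v a
      by blast
    have \<chi>_eq: "\<chi> (case_sum v (case_sum (params a') a)) \<longleftrightarrow>
      (\<forall>u. \<delta> (case_sum (v(e := u)) (params a')) \<longrightarrow> P (case_sum (v(e := u)) a))" for v a
      by (simp add: \<chi>_def case_sum_upd_Inl case_sum_o_map_sum case_sum_o_inj)
    have \<Psi>_eq: "\<Psi> (case_sum v (case_sum c (params a'))) \<longleftrightarrow> \<xi> (case_sum v c) \<and> \<delta> (case_sum v (params a'))" for v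
      by (simp add: \<Psi>_def case_sum_o_map_sum case_sum_o_inj)
    have "P (case_sum v a)" if v: "\<Psi> (case_sum v (case_sum c (params a')))" and a: "a \<in> G" "P (case_sum id a)" for v a
    proof -
      have "\<chi> (case_sum id (case_sum (params a') a))"
        unfolding \<chi>_eq \<delta>_N using a'(3)[OF a] by blast
      then have "\<chi> (case_sum v (case_sum (params a') a))" using \<chi>[of v a] v a by (simp add: \<Psi>_eq)
      then show ?thesis using v unfolding \<chi>_eq \<Psi>_eq by (metis fun_upd_triv)
    qed
    moreover have "\<Psi> (case_sum id (case_sum c (params a')))"
      using c(2) a'(2) \<delta>_N[of e a'] by (simp add: \<Psi>_eq fun_upd_idem)
    moreover have "range (case_sum c (params a')) \<subseteq> A"
      using c(1) params by (auto simp: image_subset_iff split: sum.splits)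
    ultimately show "\<exists>c. range c \<subseteq> A \<and> \<Psi> (case_sum id c) \<and>
      (\<forall>v. \<Psi> (case_sum v c) \<longrightarrow> (\<forall>a\<in>G. P (case_sum id a) \<longrightarrow> P (case_sum v a)))"
      by blast
  qed
  then show ?thesis by blast
qed

text \<open>Otherwise an \<open>obstruction\<close> arises: \<open>H\<close> comes from
  compressibility of \<open>e\<close>, \<open>NC\<close> from
  \<open>compresses_positive_if_no_witnesses\<close>, and both bounds on shattering from NIP of
  \<open>L'\<close>.\<close>

lemma compresses_positive_exists:
  fixes P :: "('a + nat \<Rightarrow> 'a) \<Rightarrow> bool"
  assumes P: "definable L M V P"
  shows "\<exists>\<Psi> :: ('a + nat + nat \<times> nat + 'a \<Rightarrow> 'a) \<Rightarrow> bool. compresses_positive P \<Psi>"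
proof (rule ccontr)
  assume none: "\<not> ?thesis"
  \<comment> \<open>Of the point \<open>y\<close> only the coordinate \<open>Inl e\<close> is used,
    of the parameter \<open>x\<close> all the others.\<close>
  define X where "X y x \<longleftrightarrow> \<not> P (x(Inl e := y (Inl e)))" for y x :: "'a + nat \<Rightarrow> 'a"
  \<comment> \<open>Here \<open>e\<close> is the only object variable and \<open>C\<close> belongs
    to the parameters, which is the form that \<open>comp_e\<close> treats.\<close>
  define PE where "PE v = P (v \<circ> (\<lambda>k. if k = Inl e then Inl () else Inr k))" for v
  have PE: "PE (case_sum v x) = P (x(Inl e := v ()))" for v x
    unfolding PE_def by (rule arg_cong[where f = P]) (auto simp: fun_eq_iff)
  have "definable L M (Inl ` UNIV \<union> range Inr) PE"
    unfolding PE_def by (rule definable_reindex[OF P]) auto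
  from compressibleD[OF comp_e this]
  obtain QE where QE: "definable L M (Inl ` UNIV \<union> range (Inr :: nat \<Rightarrow> _)) QE"
    and comp: "\<forall>G. finite G \<longrightarrow> (\<forall>a\<in>G. range a \<subseteq> A \<union> C) \<longrightarrow>
      (\<exists>c. range c \<subseteq> A \<union> C \<and> QE (case_sum (\<lambda>_. e) c) \<and>
        (\<forall>v. QE (case_sum v c) \<longrightarrow> (\<forall>a\<in>G. PE (case_sum v a) \<longleftrightarrow> PE (case_sum (\<lambda>_. e) a))))"
    by (elim exE conjE)
  define \<psi> where "\<psi> y c = QE (case_sum (\<lambda>_. y (Inl e)) (c \<circ> Inr))" for y c :: "'a + nat \<Rightarrow> 'a"
  define AA where "AA = norm ` {a. range a \<subseteq> A \<and> P (case_sum id a)}"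
  define CC where "CC = {c :: 'a + nat \<Rightarrow> 'a. range c \<subseteq> A \<union> C}"
  have AA_CC: "AA \<subseteq> CC" using range_norm by (auto simp: AA_def CC_def)
  have X_norm: "X y (norm a) \<longleftrightarrow> \<not> P (case_sum (id(e := y (Inl e))) a)" for y a
    unfolding X_def norm_upd[OF P] ..
  have X: "dpred L M (\<lambda>y a c. X y (a j))" for j
  proof -
    have eq: "X (v \<circ> Inl) (\<lambda>k. v (Inr (Inl (j, k)))) \<longleftrightarrow>
        \<not> P (v \<circ> (\<lambda>k. if k = Inl e then Inl (Inl e) else Inr (Inl (j, k))))" for v
      unfolding X_def by (intro arg_cong[where f = "\<lambda>z. \<not> P z"]) (auto simp: fun_eq_iff)
    show ?thesis unfolding dpred_def eq by (intro definable_not definable_reindex[OF P]) auto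
  qed
  have psi: "dpred L M (\<lambda>y a c. \<psi> y (c j))" for j
  proof -
    have eq: "\<psi> (v \<circ> Inl) (\<lambda>k. v (Inr (Inr (j, k)))) \<longleftrightarrow>
        QE (v \<circ> (case_sum (\<lambda>_. Inl (Inl e)) (\<lambda>n. Inr (Inr (j, Inr n)))))" for v
      unfolding \<psi>_def by (rule arg_cong[where f = QE]) (auto simp: fun_eq_iff split: sum.splits)
    show ?thesis unfolding dpred_def eq by (intro definable_reindex[OF QE]) auto
  qed
  interpret obstruction "{Q. dpred L M Q}" NN X \<psi> AA CC "\<lambda>_. e"
  proof (unfold_locales, unfold mem_Collect_eq)
    show "\<exists>d. \<forall>(n::nat) a c. (\<forall>I\<subseteq>{..<n}. \<exists>w. \<forall>i<n. Q w (a i) (c i) \<longleftrightarrow> i \<in> I) \<longrightarrow> n \<le> d"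
      if "dpred L M Q" for Q :: "('a + nat \<Rightarrow> 'a) \<Rightarrow> _"
      using NIP_dpred[OF NIP] that unfolding L_def M_def by blast
    show "\<exists>d. \<forall>(n::nat) a. (\<forall>I\<subseteq>{..<n}. \<exists>u. \<forall>i<n. (\<exists>y. \<psi> y u \<and> X y (a i)) \<longleftrightarrow> i \<in> I) \<longrightarrow> n \<le> d"
      using NIP_dpred_pair[OF NIP, where R = "\<lambda>u x. \<exists>y. \<psi> y u \<and> X y x"]
        dpred_ex[OF dpred_conj[OF psi[of 0] X[of 0]]]
      unfolding L_def M_def by blast
    show "(\<lambda>y E. Q y (mix p \<alpha> E) c) \<in> NN"
      if "dpred L M Q" "range \<alpha> \<subseteq> AA" "range c \<subseteq> CC" for Q \<alpha> c p
    proof (rule NN_inst[OF that(1)])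
      show "range (\<alpha> j) \<subseteq> A \<union> C" "range (c j) \<subseteq> A \<union> C" for j
        using that(2,3) AA_CC unfolding CC_def by blast+
    qed
    show "\<exists>c\<in>CC. \<psi> (\<lambda>_. e) c \<and> (\<forall>x\<in>G. \<forall>y. \<psi> y c \<longrightarrow> \<not> X y x)" if G: "finite G" "G \<subseteq> AA" for G
    proof -
      have "\<forall>a\<in>G. range a \<subseteq> A \<union> C" using G AA_CC unfolding CC_def by blast
      from comp[THEN spec, THEN mp, THEN mp, OF G(1) this]
      obtain c where c: "range c \<subseteq> A \<union> C" "QE (case_sum (\<lambda>_. e) c)"
        and c_imp: "\<forall>v. QE (case_sum v c) \<longrightarrow> (\<forall>a\<in>G. PE (case_sum v a) \<longleftrightarrow> PE (case_sum (\<lambda>_. e) a))"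
        by (elim exE conjE)
      have "\<not> X y x" if x: "x \<in> G" "\<psi> y (case_sum (\<lambda>_. a0) c)" for x y
      proof -
        obtain a where a: "x = norm a" "P (case_sum id a)" using x(1) G(2) unfolding AA_def by blast
        have "P (x(Inl e := e))" unfolding a(1) norm_upd[OF P] using a(2) by (simp add: fun_upd_idem)
        moreover have "PE (case_sum (\<lambda>_. y (Inl e)) x) \<longleftrightarrow> PE (case_sum (\<lambda>_. e) x)"
          using c_imp x unfolding \<psi>_def by (simp add: case_sum_o_inj)
        ultimately show ?thesis by (simp add: PE X_def)
      qed
      moreover have "case_sum (\<lambda>_. a0) c \<in> CC" using c(1) a0 by (auto simp: CC_def image_subset_iff split: sum.splits)
      moreover have "\<psi> (\<lambda>_. e) (case_sum (\<lambda>_. a0) c)" using c(2) by (simp add: \<psi>_def case_sum_o_inj)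
      ultimately show ?thesis by blast
    qed
    show "AA \<noteq> {}"
    proof
      assume "AA = {}"
      then have "compresses_positive P (\<lambda>_ :: 'a + nat + nat \<times> nat + 'a \<Rightarrow> 'a. True)"
        using a0 unfolding compresses_positive_def AA_def
        by (intro conjI definable_True allI impI exI[of _ "\<lambda>_. a0"]) auto
      then show False using none by blast
    qed
    show "\<exists>G. finite G \<and> G \<subseteq> AA \<and> (\<forall>E. range E \<subseteq> AA \<longrightarrow> N (\<lambda>_. e) E \<longrightarrow> (\<exists>x\<in>G. \<exists>y. X y x \<and> N y E))"
      if N: "N \<in> NN" for N
    proof (rule ccontr)
      assume no: "\<not> ?thesis"
      \<comment> \<open>If no finite \<open>G\<close> works, then every finite set of true instances
        is implied by \<open>N\<close> with some parameters, which is the hypothesis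
        \<open>no_witness\<close>.\<close>
      have "\<exists>\<Psi> :: ('a + nat + nat \<times> nat + 'a \<Rightarrow> 'a) \<Rightarrow> bool. compresses_positive P \<Psi>"
      proof (rule compresses_positive_if_no_witnesses[OF P N])
        fix G assume G: "finite G" "\<And>a. a \<in> G \<Longrightarrow> range a \<subseteq> A \<and> P (case_sum id a)"
        have "finite (norm ` G)" "norm ` G \<subseteq> AA" using G unfolding AA_def by auto
        then obtain E where E: "range E \<subseteq> AA" "N (\<lambda>_. e) E" "\<forall>x\<in>norm ` G. \<forall>y. X y x \<longrightarrow> \<not> N y E"
          using no[unfolded not_ex, THEN spec, of "norm ` G"] by blast
        have "\<forall>j. \<exists>a. E j = norm a \<and> range a \<subseteq> A" using E(1) unfolding AA_def by blast
        then obtain a' where a': "\<And>j. E j = norm (a' j)" "\<And>j. range (a' j) \<subseteq> A" by metis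
        have "E = (\<lambda>j. norm (a' j))" using a'(1) by auto
        moreover have "P (case_sum (id(e := u)) a)" if "a \<in> G" "N (\<lambda>_. u) E" for a u
          using E(3) that X_norm[of "\<lambda>_. u" a] by blast
        ultimately show "\<exists>a'. (\<forall>j. range (a' j) \<subseteq> A) \<and> N (\<lambda>_. e) (\<lambda>j. norm (a' j)) \<and>
            (\<forall>a\<in>G. \<forall>u. N (\<lambda>_. u) (\<lambda>j. norm (a' j)) \<longrightarrow> P (case_sum (id(e := u)) a))"
          using E(2) a'(2) by blast
      qed
      then show False using none by blast
    qed
    show "dpred L M (\<lambda>y a c. Q y (a \<circ> f) (c \<circ> g))" if "dpred L M Q" for Q f g
      using that by (rule dpred_reindex)
  qed (fact X psi NN_True | erule (1) dpred_conj NN_conj | erule dpred_not dpred_ex dpred_ex_upd)+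
  show False by (rule inconsistent)
qed

text \<open>The true instances of \<open>P\<close> and of its negation are compressed separately;
  the two conditions are conjoined with disjoint parameter tuples.\<close>

lemma compressible_insert: "compressible L M (insert e C) A id"
  unfolding compressible_def
proof (intro allI impI)
  fix P :: "('a + nat \<Rightarrow> 'a) \<Rightarrow> bool"
  assume "definable L M (Inl ` insert e C \<union> range Inr) P"
  then have P: "definable L M V P" by (simp add: V_def)
  obtain \<Psi>1 \<Psi>2 :: "('a + nat + nat \<times> nat + 'a \<Rightarrow> 'a) \<Rightarrow> bool"
    where \<Psi>: "compresses_positive P \<Psi>1" "compresses_positive (\<lambda>v. \<not> P v) \<Psi>2"
    using compresses_positive_exists[OF P] compresses_positive_exists[OF definable_not[OF P]] by blast
  define \<Psi> where "\<Psi> v \<longleftrightarrow> \<Psi>1 (v \<circ> map_sum id Inl) \<and> \<Psi>2 (v \<circ> map_sum id Inr)" for v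
  have "definable L M (Inl ` insert e C \<union> range Inr) \<Psi>"
    unfolding \<Psi>_def using \<Psi> unfolding compresses_positive_def V_def
    by (intro definable_conj definable_reindex[of L M _ \<Psi>1] definable_reindex[of L M _ \<Psi>2]) auto
  from definable_renumber[OF this]
  obtain Q and g :: "nat \<Rightarrow> _" where Q: "definable L M (Inl ` insert e C \<union> range Inr) Q"
    and Q_eq: "\<forall>v c. Q (case_sum v (c \<circ> g)) \<longleftrightarrow> \<Psi> (case_sum v c)"
    by (elim exE conjE)
  have "\<exists>c. range c \<subseteq> A \<and> Q (case_sum id c) \<and>
      (\<forall>v. Q (case_sum v c) \<longrightarrow> (\<forall>a\<in>G. P (case_sum v a) \<longleftrightarrow> P (case_sum id a)))"
    if G: "finite G" "\<forall>a\<in>G. range a \<subseteq> A" for G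
  proof -
    from \<Psi>(1)[unfolded compresses_positive_def, THEN conjunct2, THEN spec, THEN mp, THEN mp, OF G]
    obtain c1 where c1: "range c1 \<subseteq> A" "\<Psi>1 (case_sum id c1)"
      "\<forall>v. \<Psi>1 (case_sum v c1) \<longrightarrow> (\<forall>a\<in>G. P (case_sum id a) \<longrightarrow> P (case_sum v a))"
      by (elim exE conjE)
    from \<Psi>(2)[unfolded compresses_positive_def, THEN conjunct2, THEN spec, THEN mp, THEN mp, OF G]
    obtain c2 where c2: "range c2 \<subseteq> A" "\<Psi>2 (case_sum id c2)"
      "\<forall>v. \<Psi>2 (case_sum v c2) \<longrightarrow> (\<forall>a\<in>G. \<not> P (case_sum id a) \<longrightarrow> \<not> P (case_sum v a))"
      by (elim exE conjE)
    have eq: "Q (case_sum v (case_sum c1 c2 \<circ> g)) \<longleftrightarrow> \<Psi>1 (case_sum v c1) \<and> \<Psi>2 (case_sum v c2)" for v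
      by (simp add: Q_eq \<Psi>_def case_sum_o_map_sum case_sum_o_inj)
    have "range (case_sum c1 c2 \<circ> g) \<subseteq> A" using c1(1) c2(1) by (auto simp: image_subset_iff split: sum.splits)
    moreover have "Q (case_sum id (case_sum c1 c2 \<circ> g))" unfolding eq using c1(2) c2(2) ..
    moreover have "P (case_sum v a) \<longleftrightarrow> P (case_sum id a)"
      if "Q (case_sum v (case_sum c1 c2 \<circ> g))" "a \<in> G" for v a
      using that c1(3) c2(3) unfolding eq by metis
    ultimately show ?thesis by blast
  qed
  with Q show "\<exists>Q. definable L M (Inl ` insert e C \<union> range (Inr :: nat \<Rightarrow> _)) Q \<and>
        (\<forall>G. finite G \<longrightarrow> (\<forall>a\<in>G. range a \<subseteq> A) \<longrightarrow>
          (\<exists>c. range c \<subseteq> A \<and> Q (case_sum id c) \<and>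
            (\<forall>v. Q (case_sum v c) \<longrightarrow> (\<forall>a\<in>G. P (case_sum v (a :: nat \<Rightarrow> _)) \<longleftrightarrow> P (case_sum id a)))))"
    by blast
qed

end

section \<open>Induction along the enumeration\<close>

text \<open>Well-founded induction on the initial segments \<open>under r i\<close>. What strictly
  precedes \<open>i\<close> is the union of a chain of such segments, and then at most one element
  is added.\<close>

lemma compressible_enumeration:
  fixes b :: "'i \<Rightarrow> 'a"
  assumes "NIP L' U" and L: "L = add_constants L' F" and M: "M = name_elements U"
    and r: "Well_order r" and "A \<noteq> {}"
    and comp: "\<And>i. i \<in> Field r \<Longrightarrow> compressible L M (UNIV :: unit set) (A \<union> b ` underS r i) (\<lambda>_. b i)"
  shows "compressible L M (b ` Field r) A id"
proof -
  have "wf (r - Id)" "Total r" "trans r" "Refl r"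
    using r by (auto simp: order_on_defs)
  note Refl = \<open>Refl r\<close>
  have chain_under: "under r i \<subseteq> under r j \<or> under r j \<subseteq> under r i" if "i \<in> Field r" "j \<in> Field r" for i j
  proof -
    have "(i, j) \<in> r \<or> (j, i) \<in> r"
      using that \<open>Total r\<close> Refl unfolding total_on_def refl_on_def by metis
    then show ?thesis using \<open>trans r\<close> unfolding under_def trans_def by blast
  qed
  have Union: "compressible L M (b ` (\<Union>i\<in>I. under r i)) A id"
    if I: "I \<subseteq> Field r" and "\<And>i. i \<in> I \<Longrightarrow> compressible L M (b ` under r i) A id" for I
  proof -
    \<comment> \<open>The empty set keeps the chain nonempty when \<open>I\<close> is empty, as
      happens at the least index.\<close>
    let ?S = "insert {} ((\<lambda>i. b ` under r i) ` I)"
    have "subset.chain UNIV ?S"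
      unfolding subset_chain_def
    proof (intro conjI ballI subset_UNIV)
      fix S S' assume "S \<in> ?S" "S' \<in> ?S"
      then show "S \<subseteq> S' \<or> S' \<subseteq> S"
        using chain_under I by (elim insertE imageE) (simp_all, meson image_mono subsetD)
    qed
    moreover have "compressible L M S A id" if "S \<in> ?S" for S
      using that \<open>\<And>i. i \<in> I \<Longrightarrow> _\<close> compressible_empty[OF \<open>A \<noteq> {}\<close>] by auto
    ultimately have "compressible L M (\<Union>?S) A id" by (intro compressible_Union_chain) auto
    moreover have "\<Union>?S = b ` (\<Union>i\<in>I. under r i)" by auto
    ultimately show ?thesis by simp
  qed
  have under: "compressible L M (b ` under r i) A id" if "i \<in> Field r" for i
    using \<open>wf (r - Id)\<close> that
  proof (induction i rule: wf_induct_rule)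
    case (less i)
    have sub: "underS r i \<subseteq> Field r" by (auto simp: underS_def Field_def)
    have "(\<Union>j\<in>underS r i. under r j) = underS r i"
    proof
      show "underS r i \<subseteq> (\<Union>j\<in>underS r i. under r j)"
        using sub Refl by (auto simp: under_def refl_on_def)
      show "(\<Union>j\<in>underS r i. under r j) \<subseteq> underS r i"
        using \<open>trans r\<close> r unfolding order_on_defs under_def underS_def trans_def antisym_def by blast
    qed
    moreover have "compressible L M (b ` under r j) A id" if "j \<in> underS r i" for j
      by (rule less.IH) (use sub that in \<open>auto simp: underS_def\<close>)
    ultimately have C: "compressible L M (b ` underS r i) A id"
      using Union[OF sub] by simp
    have "under r i = insert i (underS r i)"
      using less.prems Refl by (auto simp: under_def underS_def refl_on_def)
    then have eq: "b ` under r i = insert (b i) (b ` underS r i)" by auto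
    show ?case
    proof (cases "b i \<in> b ` underS r i")
      \<comment> \<open>The enumeration may repeat an element.\<close>
      case True
      then show ?thesis unfolding eq insert_absorb[OF True] by (intro C)
    next
      case False
      obtain a0 where "a0 \<in> A" using \<open>A \<noteq> {}\<close> by blast
      interpret one_point_extension L' U F A "b ` underS r i" "b i" a0 L M
        by unfold_locales (use assms C comp less.prems False \<open>a0 \<in> A\<close> in auto)
      show ?thesis unfolding eq by (rule compressible_insert)
    qed
  qed
  have eq: "(\<Union>i\<in>Field r. under r i) = Field r"
    using Refl by (auto simp: under_def refl_on_def Field_def)
  have "compressible L M (b ` (\<Union>i\<in>Field r. under r i)) A id"
    by (rule Union) (auto intro: under)
  then show ?thesis unfolding eq .
qed

theorem proposition6p30:
  fixes L' :: "('f, 'r) fo_language"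
    and T' :: "('f, 'r, nat) fm set"
    and U :: "('f, 'r, 'a) fo_structure"
    and F A B :: "'a set"
  assumes "countable_language L'"
    and "complete_theory L' T'"
    and "monster_model L' T' U"
    and "NIP L' U"
    and "small F"
    and "small A"
    and "small B"
    and "compressibly_constructible TYPE('i) (add_constants L' F) (name_elements U) A B"
  shows "compressible_over (add_constants L' F) (name_elements U) A B"
proof -
  let ?L = "add_constants L' F" and ?M = "name_elements U"
  have "compressible_type ?L ?M B A (tp ?L ?M B id A)"
  \<comment> \<open>Over the empty set there are no infinite parameter tuples, so the semantic
    notion is available only for nonempty \<open>A\<close>.\<close>
  proof (cases "A = {}")
    case True
    then show ?thesis using compressible_type_empty by simp
  next
    case False
    obtain r :: "'i rel" and b where r: "Well_order r" "B = b ` Field r"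
      and "\<forall>i\<in>Field r. compressible_type ?L ?M (UNIV :: unit set) (A \<union> b ` underS r i)
        (tp ?L ?M UNIV (\<lambda>_. b i) (A \<union> b ` underS r i))"
      using assms(8) unfolding compressibly_constructible_def by blast
    then have "compressible ?L ?M (UNIV :: unit set) (A \<union> b ` underS r i) (\<lambda>_. b i)" if "i \<in> Field r" for i
      using that False by (intro compressible_type_imp_compressible) auto
    then have "compressible ?L ?M B A id"
      unfolding r(2) using assms(4) r(1) False by (intro compressible_enumeration) auto
    then show ?thesis using False by (rule compressible_imp_compressible_type)
  qed
  then show ?thesis
    unfolding compressible_over_def by (intro exI[of _ B] exI[of _ id]) simp
qed

end
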